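(* There exists $M\in\mathbb N$, independent of $L$ and $\delta$, such that for every $\delta>0$ sufficiently small there exists $L_0>0$ such that, for every $L>L_0$, the projective process admits a unique stationary probability measure $\nu$, which is ergodic and mixing. More precisely, for every $n\ge 0$ and every $\varphi\in L^\infty(\mathbb{PT}^2)$, $$\left\|\mathcal P_p^n\varphi-\nu(\varphi)\right\|_\infty\le 2L^{-\frac{\delta}{2}\lfloor n/M\rfloor}\|\varphi\|_\infty .$$
   Context: For $L>0$ and $\delta>0$ put $\sigma:=L^{-\delta}$ and $f(x):=L\cos(2\pi x)$. Let $\Omega:=[-\sigma,\sigma]^{\mathbb N_0}$ with the product probability measure $\mathbb P$ whose coordinate marginals are uniform on $[-\sigma,\sigma]$; $\mathbb E$ is the corresponding expectation. For $\omega=(\omega_n)_{n\ge0}\in\Omega$ define the area-preserving diffeomorphism of $\mathbb T^2=\mathbb R^2/\mathbb Z^2$ $$f_\omega(x,y)=f_{\omega_0}(x,y)=\bigl(f(x+\omega_0)-y,\;x+\omega_0\bigr)\pmod 1$$ (the random standard map). Let $\mathbb{PT}^2\simeq\mathbb T^2\times\mathbb P^1$ be the projectivized tangent bundle of $\mathbb T^2$; an element of $\mathbb P^1$ is represented by a unit vector $v\in\mathbb S^1$ with antipodal vectors identified. The projective process is the Markov chain $$(x_{n+1},y_{n+1},v_{n+1})=\left(f_{\omega_n}(x_n,y_n),\frac{Df_{\omega_n}(x_n,y_n)v_n}{|Df_{\omega_n}(x_n,y_n)v_n|}\right).$$ $L^\infty(\mathbb{PT}^2)$ is the Banach space of bounded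 measurable functions with the supremum norm $\|\cdot\|_\infty$, and the Koopman operator is $$\mathcal P_p\phi(x,y,v):=\mathbb E\left[\phi\left(f_\omega(x,y),\frac{Df_\omega(x,y)v}{|Df_\omega(x,y)v|}\right)\right].$$ A probability measure $\nu$ is stationary if $\int\mathcal P_p\phi\,d\nu=\int\phi\,d\nu$ for all $\phi\in L^\infty(\mathbb{PT}^2)$; $\nu(\varphi)=\int\varphi\,d\nu$. *)

theory Defs
  imports "HOL-Probability.Probability"
begin

section \<open>The torus and the projective line as topological quotients\<close>

definition torus_rel :: "real \<times> real \<Rightarrow> real \<times> real \<Rightarrow> bool" where
  "torus_rel p q \<longleftrightarrow> fst p - fst q \<in> \<int> \<and> snd p - snd q \<in> \<int>"

quotient_type torus = "real \<times> real" / torus_rel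
proof (rule equivpI)
  show "reflp torus_rel" by (auto simp: reflp_def torus_rel_def)
  show "symp torus_rel"
    unfolding symp_def torus_rel_def by (metis Ints_minus minus_diff_eq)
  show "transp torus_rel"
    unfolding transp_def torus_rel_def
    by (metis (no_types, lifting) Ints_add diff_add_cancel add_diff_eq)
qed

definition antipodal_rel :: "real \<times> real \<Rightarrow> real \<times> real \<Rightarrow> bool" where
  "antipodal_rel u v \<longleftrightarrow> norm u = 1 \<and> norm v = 1 \<and> (u = v \<or> u = - v)"

quotient_type proj_line = "real \<times> real" / partial: antipodal_rel
proof (rule part_equivpI)
  show "\<exists>u. antipodal_rel u u"
    by (rule exI[of _ "(1, 0)"]) (simp add: antipodal_rel_def norm_Pair)
  show "symp antipodal_rel" by (auto simp: symp_def antipodal_rel_def)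
  show "transp antipodal_rel" by (auto simp: transp_def antipodal_rel_def)
qed

instantiation torus :: topological_space
begin

definition open_torus :: "torus set \<Rightarrow> bool" where
  "open_torus U \<longleftrightarrow> open (abs_torus -` U)"

instance
proof
  show "open (UNIV :: torus set)" by (simp add: open_torus_def)
next
  fix S T :: "torus set"
  assume "open S" "open T"
  then show "open (S \<inter> T)" by (simp add: open_torus_def open_Int)
next
  fix K :: "torus set set"
  assume "\<forall>S\<in>K. open S"
  then show "open (\<Union>K)" by (auto simp: open_torus_def vimage_Union)
qed

end

text \<open>Since \<open>abs_proj_line\<close> is meaningful on unit vectors only, the quotient topology is taken
  from the circle with its subspace topology.\<close>

instantiation proj_line :: topological_space
begin

definition open_proj_line :: "proj_line set \<Rightarrow> bool" where
  "open_proj_line U \<longleftrightarrow>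
     openin (top_of_set (sphere 0 1)) {v \<in> sphere 0 1. abs_proj_line v \<in> U}"

instance
proof
  have "{v \<in> sphere 0 1. abs_proj_line v \<in> UNIV} = sphere 0 1" by auto
  then show "open (UNIV :: proj_line set)"
    unfolding open_proj_line_def by (metis openin_subtopology_self)
next
  fix S T :: "proj_line set"
  assume "open S" "open T"
  then have "openin (top_of_set (sphere 0 1))
     ({v \<in> sphere 0 1. abs_proj_line v \<in> S} \<inter> {v \<in> sphere 0 1. abs_proj_line v \<in> T})"
    unfolding open_proj_line_def by (rule openin_Int)
  also have "{v \<in> sphere 0 1. abs_proj_line v \<in> S} \<inter> {v \<in> sphere 0 1. abs_proj_line v \<in> T}
      = {v \<in> sphere 0 1. abs_proj_line v \<in> S \<inter> T}" by auto
  finally show "open (S \<inter> T)" unfolding open_proj_line_def .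
next
  fix K :: "proj_line set set"
  assume "\<forall>S\<in>K. open S"
  then have "openin (top_of_set (sphere 0 1)) (\<Union>S\<in>K. {v \<in> sphere 0 1. abs_proj_line v \<in> S})"
    unfolding open_proj_line_def by (intro openin_Union) auto
  also have "(\<Union>S\<in>K. {v \<in> sphere 0 1. abs_proj_line v \<in> S})
      = {v \<in> sphere 0 1. abs_proj_line v \<in> \<Union>K}" by auto
  finally show "open (\<Union>K)" unfolding open_proj_line_def .
qed

end

text \<open>The tangent bundle of the torus is trivial, so its projectivization is a product.\<close>

type_synonym proj_bundle = "torus \<times> proj_line"


section \<open>The random standard map and its projective action\<close>

definition std_f :: "real \<Rightarrow> real \<Rightarrow> real" where
  "std_f L x = L * cos (2 * pi * x)"

definition std_map_plane :: "real \<Rightarrow> real \<Rightarrow> real \<times> real \<Rightarrow> real \<times> real" where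
  "std_map_plane L w p = (std_f L (fst p + w) - snd p, fst p + w)"

lemma std_map_plane_has_derivative:
  "(std_map_plane L w has_derivative
     (\<lambda>v. (- 2 * pi * L * sin (2 * pi * (fst p + w)) * fst v - snd v, fst v))) (at p)"
  unfolding std_map_plane_def std_f_def
  by (auto intro!: derivative_eq_intros simp: algebra_simps)

lemma frechet_derivative_std_map_plane:
  "frechet_derivative (std_map_plane L w) (at p) =
     (\<lambda>v. (- 2 * pi * L * sin (2 * pi * (fst p + w)) * fst v - snd v, fst v))"
  using frechet_derivative_at[OF std_map_plane_has_derivative] by simp

lemma trig_2pi_cong:
  fixes x y :: real
  assumes "x - y \<in> \<int>"
  shows "cos (2 * pi * x) = cos (2 * pi * y)" "sin (2 * pi * x) = sin (2 * pi * y)"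
proof -
  obtain k :: int where "x - y = of_int k" using assms by (elim Ints_cases)
  then have x: "2 * pi * x = 2 * pi * y + 2 * pi * of_int k" by (simp add: algebra_simps)
  show "cos (2 * pi * x) = cos (2 * pi * y)" "sin (2 * pi * x) = sin (2 * pi * y)"
    unfolding x by (simp_all add: cos_add sin_add cos_int_2pin sin_int_2pin)
qed

lift_definition std_map :: "real \<Rightarrow> real \<Rightarrow> torus \<Rightarrow> torus" is std_map_plane
proof -
  fix L w and p q :: "real \<times> real"
  assume *: "torus_rel p q"
  then have "(fst p + w) - (fst q + w) \<in> \<int>" by (simp add: torus_rel_def)
  from trig_2pi_cong(1)[OF this] * show "torus_rel (std_map_plane L w p) (std_map_plane L w q)"
    by (auto simp: torus_rel_def std_map_plane_def std_f_def
          intro: Ints_minus[of "snd p - snd q", simplified])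
qed

text \<open>\<open>sgn u = u /\<^sub>R norm u\<close> normalises the image of a unit vector under the derivative.\<close>

lift_definition proj_action :: "real \<Rightarrow> real \<Rightarrow> torus \<Rightarrow> proj_line \<Rightarrow> proj_line" is
  "\<lambda>L w p v. sgn (frechet_derivative (std_map_plane L w) (at p) v)"
proof -
  fix L w and p q u v :: "real \<times> real"
  assume pq: "torus_rel p q" and uv: "antipodal_rel u v"
  let ?D = "\<lambda>p. frechet_derivative (std_map_plane L w) (at p)"
  have "(fst p + w) - (fst q + w) \<in> \<int>" using pq by (simp add: torus_rel_def)
  from trig_2pi_cong(2)[OF this] have D: "?D p = ?D q"
    by (simp add: frechet_derivative_std_map_plane)
  have nz: "?D q z \<noteq> 0" if "norm z = 1" for z
    using that by (cases z) (auto simp: frechet_derivative_std_map_plane zero_prod_def)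
  have minus: "?D q (- z) = - ?D q z" for z
    by (simp add: frechet_derivative_std_map_plane)
  show "antipodal_rel (sgn (?D p u)) (sgn (?D q v))"
    using uv nz[of u] nz[of v] minus[of v]
    by (auto simp: antipodal_rel_def D norm_sgn sgn_minus)
qed

definition proj_step :: "real \<Rightarrow> real \<Rightarrow> proj_bundle \<Rightarrow> proj_bundle" where
  "proj_step L w z = (std_map L w (fst z), proj_action L w (fst z) (snd z))"


section \<open>Noise, Koopman operator and stationary measures\<close>

text \<open>Product over all of \<open>nat \<Rightarrow> real\<close>, with marginals concentrated on
  \<open>[-\<sigma>, \<sigma>]\<close>, \<open>\<sigma> = L\<^sup>-\<^sup>\<delta>\<close>.\<close>

definition noise :: "real \<Rightarrow> real \<Rightarrow> (nat \<Rightarrow> real) measure" where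
  "noise L \<delta> =
     (\<Pi>\<^sub>M n\<in>UNIV. uniform_measure lborel {- (L powr (- \<delta>)) .. L powr (- \<delta>)})"

definition bdd_measurable :: "(proj_bundle \<Rightarrow> real) \<Rightarrow> bool" where
  "bdd_measurable \<phi> \<longleftrightarrow> \<phi> \<in> borel_measurable borel \<and> bounded (range \<phi>)"

text \<open>A genuine supremum: functions are not identified modulo null sets.\<close>

definition sup_norm :: "(proj_bundle \<Rightarrow> real) \<Rightarrow> real" where
  "sup_norm \<phi> = (SUP z. \<bar>\<phi> z\<bar>)"

definition koopman :: "real \<Rightarrow> real \<Rightarrow> (proj_bundle \<Rightarrow> real) \<Rightarrow> proj_bundle \<Rightarrow> real" where
  "koopman L \<delta> \<phi> z = (\<integral>\<omega>. \<phi> (proj_step L (\<omega> 0) z) \<partial>noise L \<delta>)"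

definition stationary :: "real \<Rightarrow> real \<Rightarrow> proj_bundle measure \<Rightarrow> bool" where
  "stationary L \<delta> \<nu> \<longleftrightarrow> prob_space \<nu> \<and> sets \<nu> = sets borel \<and>
     (\<forall>\<phi>. bdd_measurable \<phi> \<longrightarrow> (\<integral>z. koopman L \<delta> \<phi> z \<partial>\<nu>) = (\<integral>z. \<phi> z \<partial>\<nu>))"

text \<open>Ergodicity and mixing of a stationary measure are those of the Markov operator: bounded
  functions invariant \<open>\<nu>\<close>-a.e. are constant \<open>\<nu>\<close>-a.e.; correlations of bounded observables
  decay.\<close>

definition ergodic :: "real \<Rightarrow> real \<Rightarrow> proj_bundle measure \<Rightarrow> bool" where
  "ergodic L \<delta> \<nu> \<longleftrightarrow> stationary L \<delta> \<nu> \<and>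
     (\<forall>\<phi>. bdd_measurable \<phi> \<longrightarrow> (AE z in \<nu>. koopman L \<delta> \<phi> z = \<phi> z) \<longrightarrow>
          (\<exists>c. AE z in \<nu>. \<phi> z = c))"

definition mixing :: "real \<Rightarrow> real \<Rightarrow> proj_bundle measure \<Rightarrow> bool" where
  "mixing L \<delta> \<nu> \<longleftrightarrow> stationary L \<delta> \<nu> \<and>
     (\<forall>\<phi> \<psi>. bdd_measurable \<phi> \<longrightarrow> bdd_measurable \<psi> \<longrightarrow>
        (\<lambda>n. \<integral>z. (koopman L \<delta> ^^ n) \<phi> z * \<psi> z \<partial>\<nu>)
           \<longlonglongrightarrow> (\<integral>z. \<phi> z \<partial>\<nu>) * (\<integral>z. \<psi> z \<partial>\<nu>))"

end

(*
  In the coordinates u_n = x_n + w_n (angle) and v = (1, r) (direction) one step of the projective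
  process is (x, y, r) |-> (f(u) - y, u, 1 / (f'(u) - r)) with u uniform on [x - s, x + s],
  s = L^(-delta). Since s is much larger than 1/L, the fast variables cos(2 pi u) and sin(2 pi u)
  are smeared out: replacing sin(2 pi u) by sin(2 pi u) + e in an average over u of a bounded
  function that is Lipschitz in the slow variable u costs little (substitute t = sin(2 pi u) on each
  monotone branch and discard small neighbourhoods of the critical points). This gives, up to
  errors bounded by negative powers of L:
   - equidistribution of f(u) mod 1 (average the shift over e in [0, 1/L]), so that three steps
     forget the position of observables of (x, y) alone;
   - after one step |r| <= L^(-1/2) with high probability;
   - for such r, three steps forget r: the shift e = r / (2 pi L) turns f'(u) - r into f'(u), and
     two further steps are Lipschitz in (x, y).
  Hence six steps contract the oscillation of every bounded observable by L^(-delta/2), which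
  makes the iterates of the Koopman operator uniformly Cauchy.
*)
theory Submission
  imports Defs
begin

section \<open>Quotient coordinates on the projective bundle\<close>

text \<open>Observables are only bounded and measurable and the norm is a true supremum, so all
  regularity must come from the noise. Averaging over a window of half-width s makes one step
  Lipschitz in x with constant B/s; since y enters only through f(u) - y, a second step adds y. No
  such bound is derived in the direction r, so r has to be removed by the shift. There the slow
  variable u also carries the base point f(u) - y, with Lipschitz constant of order L/s, while the
  shift has size |r|/(2 pi L): the powers of L cancel and |r| is left, up to powers of s and of the
  cutoff k below. This is why directions must be nearly horizontal beforehand. Discarding points
  within k of the critical points costs k/s, and the second derivative of arcsin there costs k^(-3).
  With k = L^(-1/16) and |r| \<le> L^(-1/2) the dominant error is k/s = L^(-1/16 + \<delta>), which
  beats L^(-\<delta>/2) only for small \<delta>. On the abstract side, contraction of the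
  oscillation forces the iterates to converge uniformly to constants. This limit functional is
  positive, linear and continuous under bounded pointwise convergence: it is the stationary
  measure.\<close>

text \<open>\<open>line_of 0\<close> is junk, since \<open>sgn 0 = 0\<close> is not a unit vector.\<close>

definition line_of :: "real \<times> real \<Rightarrow> proj_line" where
  "line_of v = abs_proj_line (sgn v)"

lemma antipodal_rel_sgn: "v \<noteq> 0 \<Longrightarrow> antipodal_rel (sgn v) (sgn v)"
  by (simp add: antipodal_rel_def norm_sgn)

lemma abs_proj_line_eq_iff:
  assumes "norm u = 1" "norm v = 1"
  shows "abs_proj_line u = abs_proj_line v \<longleftrightarrow> u = v \<or> u = - v"
proof -
  have "abs_proj_line u = abs_proj_line v \<longleftrightarrow> antipodal_rel u v"
    using Quotient3_rel[OF Quotient3_proj_line, of u v] assms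
    by (auto simp: antipodal_rel_def)
  then show ?thesis using assms by (auto simp: antipodal_rel_def)
qed

lemma line_of_surj: obtains v where "l = line_of v" "v \<noteq> 0"
proof -
  define u where "u = rep_proj_line l"
  have u: "antipodal_rel u u" "l = abs_proj_line u"
    using Quotient3_rep_reflp[OF Quotient3_proj_line, of l]
      Quotient3_abs_rep[OF Quotient3_proj_line, of l]
    by (simp_all add: u_def)
  then have "norm u = 1" by (simp add: antipodal_rel_def)
  then have "l = line_of u" "u \<noteq> 0" using u by (auto simp: line_of_def sgn_div_norm)
  then show ?thesis using that by blast
qed

lemma line_of_scaleR: "c \<noteq> 0 \<Longrightarrow> v \<noteq> 0 \<Longrightarrow> line_of (c *\<^sub>R v) = line_of v"
  unfolding line_of_def
  by (subst abs_proj_line_eq_iff) (auto simp: norm_sgn sgn_scaleR sgn_if)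

lemma line_of_eqD:
  assumes "line_of u = line_of v" "u \<noteq> 0" "v \<noteq> 0"
  obtains c where "c \<noteq> 0" "u = c *\<^sub>R v"
proof -
  have u: "norm u *\<^sub>R sgn u = u" and v: "inverse (norm v) *\<^sub>R v = sgn v"
    using assms by (simp_all add: sgn_div_norm)
  have "sgn u = sgn v \<or> sgn u = - sgn v"
    using assms abs_proj_line_eq_iff[of "sgn u" "sgn v"] by (simp add: line_of_def norm_sgn)
  then show ?thesis
  proof
    assume *: "sgn u = sgn v"
    have "u = (norm u * inverse (norm v)) *\<^sub>R v"
      unfolding scaleR_scaleR[symmetric] v *[symmetric] u ..
    then show ?thesis
      using that[of "norm u * inverse (norm v)"] assms by simp
  next
    assume "sgn u = - sgn v"
    then have *: "- sgn v = sgn u" by simp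
    have "u = - (norm u * inverse (norm v)) *\<^sub>R v"
      unfolding scaleR_minus_left scaleR_minus_right[symmetric] scaleR_scaleR[symmetric] v * u ..
    then show ?thesis
      using that[of "- (norm u * inverse (norm v))"] assms by simp
  qed
qed

abbreviation tor :: "real \<Rightarrow> real \<Rightarrow> torus" where
  "tor x y \<equiv> abs_torus (x, y)"

lemma abs_torus_eq_iff: "abs_torus p = abs_torus q \<longleftrightarrow> torus_rel p q"
  by (simp add: torus.abs_eq_iff)

lemma abs_torus_surj: obtains x y where "t = abs_torus (x, y)"
proof -
  have "t = tor (fst (rep_torus t)) (snd (rep_torus t))"
    by (simp add: Quotient3_abs_rep[OF Quotient3_torus])
  then show ?thesis by (rule that)
qed

lemma continuous_abs_torus: "continuous_on UNIV abs_torus"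
  by (subst continuous_on_open_vimage) (simp_all add: open_torus_def)

text \<open>The saturation of V under the equivalence is the union of its integer translates, each
  of which is open.\<close>

lemma open_map_abs_torus:
  assumes "open V"
  shows "open (abs_torus ` V)"
proof -
  have "abs_torus -` (abs_torus ` V) = (\<Union>k\<in>\<int>\<times>\<int>. (+) k ` V)"
  proof (intro set_eqI iffI)
    fix p assume "p \<in> abs_torus -` (abs_torus ` V)"
    then obtain q where q: "q \<in> V" "torus_rel p q" by (auto simp: abs_torus_eq_iff)
    then have "p - q \<in> \<int> \<times> \<int>" by (simp add: torus_rel_def mem_Times_iff)
    moreover have "p \<in> (+) (p - q) ` V" using q(1) by (intro image_eqI[of _ _ q]) auto
    ultimately show "p \<in> (\<Union>k\<in>\<int>\<times>\<int>. (+) k ` V)" by (rule UN_I)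
  next
    fix p assume "p \<in> (\<Union>k\<in>\<int>\<times>\<int>. (+) k ` V)"
    then obtain k q where "k \<in> \<int> \<times> \<int>" "q \<in> V" "p = k + q" by auto
    then have "torus_rel p q" by (auto simp: torus_rel_def)
    then show "p \<in> abs_torus -` (abs_torus ` V)" using \<open>q \<in> V\<close> by (auto simp: abs_torus_eq_iff)
  qed
  moreover have "open \<dots>" using assms by (intro open_UN) (auto simp: open_translation)
  ultimately show ?thesis by (simp add: open_torus_def)
qed

text \<open>The topology of the projective line is tested on the circle; off the origin
  \<open>sgn\<close> is a continuous retraction onto the circle, so preimages under
  \<open>line_of\<close> are \<open>sgn\<close>-preimages of ambient open sets.\<close>

lemma continuous_line_of: "continuous_on (- {0}) line_of"
proof (subst continuous_on_open_vimage)
  show "open (- {0::real \<times> real})" by (intro open_Compl closed_singleton)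
  show "\<forall>U. open U \<longrightarrow> open (line_of -` U \<inter> - {0})"
  proof (intro allI impI)
    fix U :: "proj_line set" assume "open U"
    then obtain T where T: "open T" "{v \<in> sphere 0 1. abs_proj_line v \<in> U} = sphere 0 1 \<inter> T"
      by (auto simp: open_proj_line_def openin_open)
    have "sgn v \<in> T \<longleftrightarrow> line_of v \<in> U" if "v \<noteq> 0" for v
    proof -
      have "norm (sgn v) = 1" using that by (simp add: norm_sgn)
      then have "line_of v \<in> U \<longleftrightarrow> sgn v \<in> {v \<in> sphere 0 1. abs_proj_line v \<in> U}"
        "sgn v \<in> sphere 0 1 \<inter> T \<longleftrightarrow> sgn v \<in> T" by (simp_all add: line_of_def)
      then show ?thesis unfolding T(2) by blast
    qed
    then have "v \<in> line_of -` U \<inter> - {0} \<longleftrightarrow> v \<in> sgn -` T \<inter> - {0}" for v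
      by (cases "v = 0") simp_all
    then have "line_of -` U \<inter> - {0} = sgn -` T \<inter> - {0}" by (rule set_eqI)
    moreover have "continuous_on (- {0}) (sgn :: real \<times> real \<Rightarrow> _)"
      unfolding sgn_div_norm by (intro continuous_intros) auto
    then have "open (sgn -` T \<inter> - {0 :: real \<times> real})"
      using T(1) by (subst (asm) continuous_on_open_vimage) (simp_all add: open_Compl)
    ultimately show "open (line_of -` U \<inter> - {0})" by simp
  qed
qed

text \<open>On the circle, the saturation of V is the trace of the union of all nonzero multiples of
  V.\<close>

lemma open_map_line_of:
  assumes "open V" "V \<subseteq> - {0}"
  shows "open (line_of ` V)"
proof -
  have "{v \<in> sphere 0 1. abs_proj_line v \<in> line_of ` V} = sphere 0 1 \<inter> (\<Union>c\<in>-{0}. (*\<^sub>R) c ` V)"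
  proof (intro set_eqI iffI)
    fix v assume "v \<in> {v \<in> sphere 0 1. abs_proj_line v \<in> line_of ` V}"
    then obtain u where u: "norm v = 1" "u \<in> V" "abs_proj_line v = line_of u" by auto
    have "line_of v = line_of u" using u by (simp add: line_of_def sgn_div_norm)
    moreover have "v \<noteq> 0" "u \<noteq> 0" using u assms by auto
    ultimately obtain c where "c \<noteq> 0" "v = c *\<^sub>R u" by (rule line_of_eqD)
    then show "v \<in> sphere 0 1 \<inter> (\<Union>c\<in>-{0}. (*\<^sub>R) c ` V)" using u by auto
  next
    fix v assume "v \<in> sphere 0 1 \<inter> (\<Union>c\<in>-{0}. (*\<^sub>R) c ` V)"
    then have "norm v = 1" "\<exists>c u. c \<noteq> 0 \<and> u \<in> V \<and> v = c *\<^sub>R u" by (simp, blast)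
    then obtain c u where c: "norm v = 1" "c \<noteq> 0" "u \<in> V" "v = c *\<^sub>R u" by blast
    have "u \<noteq> 0" using c assms by auto
    then have "line_of v = line_of u" using c by (simp add: line_of_scaleR)
    moreover have "line_of v = abs_proj_line v" using c by (simp add: line_of_def sgn_div_norm)
    ultimately have "abs_proj_line v \<in> line_of ` V" using c(3) by (metis image_eqI)
    then show "v \<in> {v \<in> sphere 0 1. abs_proj_line v \<in> line_of ` V}" using c(1) by simp
  qed
  moreover have "open (\<Union>c\<in>-{0}. (*\<^sub>R) c ` V)"
    using assms by (intro open_UN) (auto simp: open_scaling)
  ultimately show ?thesis
    unfolding open_proj_line_def by (simp add: openin_open_Int)
qed

section \<open>Second countability of the quotients\<close>

text \<open>Second countability is what lets \<open>borel_prod\<close> identify the Borel sets of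
  the bundle with the product sigma-algebra. It passes through an open continuous surjection because
  the images of a countable basis form a basis.\<close>

lemma second_countable_open_image:
  fixes f :: "'a::second_countable_topology \<Rightarrow> 'b::topological_space"
  assumes S: "open S" "f ` S = UNIV" "continuous_on S f"
    and op: "\<And>U. open U \<Longrightarrow> U \<subseteq> S \<Longrightarrow> open (f ` U)"
  shows "\<exists>B::'b set set. countable B \<and> open = generate_topology B"
proof -
  obtain C :: "'a set set" where C: "countable C" "topological_basis C"
    using ex_countable_basis by blast
  let ?B = "(\<lambda>U. f ` (U \<inter> S)) ` C"
  have "topological_basis ?B"
  proof (rule topological_basisI)
    fix V assume "V \<in> ?B"
    then show "open V" using op S(1) topological_basis_open[OF C(2)] by (auto simp: open_Int)
  next
    fix V and y :: 'b assume V: "open V" "y \<in> V"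
    then obtain x where x: "x \<in> S" "y = f x" using S(2) by auto
    have "open (f -` V \<inter> S)" using S V by (simp add: continuous_on_open_vimage)
    then obtain U where "U \<in> C" "x \<in> U" "U \<subseteq> f -` V \<inter> S"
      using topological_basisE[OF C(2)] x V by (metis Int_iff vimageI)
    then show "\<exists>B'\<in>?B. y \<in> B' \<and> B' \<subseteq> V"
      using x by (intro bexI[of _ "f ` (U \<inter> S)"]) auto
  qed
  then show ?thesis
    using C(1) topological_basis_imp_subbasis by blast
qed

instance torus :: second_countable_topology
proof
  have "abs_torus ` UNIV = UNIV" by (metis abs_torus_surj surj_def)
  then show "\<exists>B::torus set set. countable B \<and> open = generate_topology B"
    by (intro second_countable_open_image[of UNIV abs_torus])
      (auto simp: continuous_abs_torus open_map_abs_torus)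
qed

instance proj_line :: second_countable_topology
proof
  have "l \<in> line_of ` (- {0})" for l by (rule line_of_surj[of l]) auto
  then show "\<exists>B::proj_line set set. countable B \<and> open = generate_topology B"
    by (intro second_countable_open_image[of "- {0}" line_of])
      (auto simp: continuous_line_of open_map_line_of)
qed

text \<open>A product of quotient maps need not be a quotient map, but a product of open maps is
  open; openness is therefore the property carried over to the bundle.\<close>

lemma open_map_map_prod:
  fixes f :: "'a::topological_space \<Rightarrow> 'b::topological_space"
    and g :: "'c::topological_space \<Rightarrow> 'd::topological_space"
  assumes f: "\<And>U. open U \<Longrightarrow> U \<subseteq> S \<Longrightarrow> open (f ` U)"
    and g: "\<And>U. open U \<Longrightarrow> U \<subseteq> T \<Longrightarrow> open (g ` U)"
    and W: "open W" "W \<subseteq> S \<times> T"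
  shows "open (map_prod f g ` W)"
  unfolding open_prod_def
proof
  fix y assume "y \<in> map_prod f g ` W"
  then obtain a b where ab: "(a, b) \<in> W" "y = (f a, g b)" by auto
  obtain A B where AB: "open A" "open B" "(a, b) \<in> A \<times> B" "A \<times> B \<subseteq> W"
    using W(1) ab(1) by (auto elim: open_prod_elim)
  moreover have "A \<subseteq> S" "B \<subseteq> T" using AB W(2) by auto
  ultimately have "open (f ` A)" "open (g ` B)" using f g by auto
  moreover have "y \<in> f ` A \<times> g ` B" "f ` A \<times> g ` B \<subseteq> map_prod f g ` W" using AB ab by force+
  ultimately show "\<exists>A B. open A \<and> open B \<and> y \<in> A \<times> B \<and> A \<times> B \<subseteq> map_prod f g ` W" by blast
qed

section \<open>The projective step in homogeneous coordinates\<close>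

definition dstd_f :: "real \<Rightarrow> real \<Rightarrow> real" where
  "dstd_f L x = - 2 * pi * L * sin (2 * pi * x)"

text \<open>The derivative is linear, so normalising before or after it does not change the line.
  Every later computation can thus use an arbitrary nonzero representative, in particular (1,
  r).\<close>

lemma proj_step_lift:
  assumes "v \<noteq> 0"
  shows "proj_step L w (tor x y, line_of v)
    = (tor (std_f L (x + w) - y) (x + w), line_of (dstd_f L (x + w) * fst v - snd v, fst v))"
proof -
  have "(dstd_f L (x + w) * fst (sgn v) - snd (sgn v), fst (sgn v))
    = inverse (norm v) *\<^sub>R (dstd_f L (x + w) * fst v - snd v, fst v)"
    by (simp add: sgn_div_norm algebra_simps)
  moreover have "(dstd_f L (x + w) * fst v - snd v, fst v) \<noteq> 0"
    using assms by (cases v) (auto simp: zero_prod_def)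
  ultimately have *: "line_of (dstd_f L (x + w) * fst (sgn v) - snd (sgn v), fst (sgn v))
    = line_of (dstd_f L (x + w) * fst v - snd v, fst v)"
    using assms line_of_scaleR[of "inverse (norm v)" "(dstd_f L (x + w) * fst v - snd v, fst v)"]
    by (metis inverse_nonzero_iff_nonzero norm_eq_zero)
  show ?thesis
    using proj_action.abs_eq[OF antipodal_rel_sgn[OF assms], of L w "(x, y)"] *
    by (simp add: proj_step_def std_map.abs_eq std_map_plane_def line_of_def
        frechet_derivative_std_map_plane dstd_f_def)
qed

text \<open>The quotient map \<open>?q\<close> is open, so the preimage of U is the open image of
  the preimage under the lifted formula \<open>?F\<close>. Continuity is joint in noise and point,
  since averages over the noise must be measurable in the point.\<close>

lemma continuous_proj_step:
  "continuous_on UNIV (\<lambda>(w, z). proj_step L w z)"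
proof (subst continuous_on_open_vimage[OF open_UNIV], intro allI impI)
  fix U :: "proj_bundle set" assume U: "open U"
  let ?q = "map_prod (\<lambda>w::real. w) (map_prod abs_torus line_of)"
  let ?S = "UNIV \<times> UNIV \<times> (- {0 :: real \<times> real})"
  let ?F = "\<lambda>(w::real, p::real \<times> real, v::real \<times> real).
    (abs_torus (std_f L (fst p + w) - snd p, fst p + w), line_of (dstd_f L (fst p + w) * fst v - snd v, fst v))"
  have S: "open ?S" by (intro open_Times) auto
  have "continuous_on ?S ?F"
    unfolding split_beta std_f_def dstd_f_def
    by (intro continuous_on_Pair continuous_on_compose2[OF continuous_abs_torus]
        continuous_on_compose2[OF continuous_line_of] continuous_intros)
      (auto simp: zero_prod_def)
  then have "open (?F -` U \<inter> ?S)"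
    using U by (subst (asm) continuous_on_open_vimage[OF S]) blast
  then have "open (?q ` (?F -` U \<inter> ?S))"
    by (rule open_map_map_prod[rotated 2, where S=UNIV and T="UNIV \<times> - {0}"])
      (auto intro!: open_map_map_prod[where S=UNIV and T="- {0}"] open_map_abs_torus open_map_line_of)
  moreover have "(\<lambda>(w, z). proj_step L w z) -` U \<inter> UNIV = ?q ` (?F -` U \<inter> ?S)" (is "?A = ?B")
  proof (intro set_eqI iffI)
    fix a assume a: "a \<in> ?A"
    obtain w t l where wtl: "a = (w, t, l)" by (cases a) auto
    obtain x y where t: "t = tor x y" by (rule abs_torus_surj)
    obtain v where v: "l = line_of v" "v \<noteq> 0" by (rule line_of_surj)
    have "(w, (x, y), v) \<in> ?F -` U \<inter> ?S" using a by (simp add: wtl t v proj_step_lift)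
    moreover have "a = ?q (w, (x, y), v)" by (simp add: wtl t v)
    ultimately show "a \<in> ?B" by blast
  next
    fix a assume "a \<in> ?B"
    then obtain b where b: "a = ?q b" "b \<in> ?F -` U" "b \<in> ?S" by (elim imageE IntE)
    obtain w x y v where "b = (w, (x, y), v)" by (metis surj_pair)
    with b have "a = ?q (w, (x, y), v)" "(w, (x, y), v) \<in> ?F -` U" "v \<noteq> 0" by blast+
    then show "a \<in> ?A" by (simp add: proj_step_lift)
  qed
  ultimately show "open ((\<lambda>(w, z). proj_step L w z) -` U \<inter> UNIV)" by simp
qed

lemma measurable_proj_step:
  "(\<lambda>(w, z). proj_step L w z) \<in> borel \<Otimes>\<^sub>M borel \<rightarrow>\<^sub>M borel"
  using borel_measurable_continuous_onI[OF continuous_proj_step] by (simp add: borel_prod)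

section \<open>Random maps contracting the oscillation\<close>

text \<open>An arbitrary bound B takes the place of the supremum norm: such bounds add up and
  survive averaging without any computation of suprema.\<close>

definition bounded_borel :: "real \<Rightarrow> ('a::topological_space \<Rightarrow> real) \<Rightarrow> bool" where
  "bounded_borel B \<phi> \<longleftrightarrow> \<phi> \<in> borel_measurable borel \<and> (\<forall>z. \<bar>\<phi> z\<bar> \<le> B)"

lemma bounded_borelD:
  assumes "bounded_borel B \<phi>"
  shows "\<phi> \<in> borel_measurable borel" "\<bar>\<phi> z\<bar> \<le> B"
  using assms by (auto simp: bounded_borel_def)

lemma bounded_borel_nonneg: "bounded_borel B \<phi> \<Longrightarrow> 0 \<le> B"
  using abs_ge_zero order_trans by (metis bounded_borelD(2))

lemma bounded_borel_const: "bounded_borel \<bar>c\<bar> (\<lambda>z. c)"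
  by (simp add: bounded_borel_def)

lemma bounded_borel_add:
  "bounded_borel B \<phi> \<Longrightarrow> bounded_borel C \<psi> \<Longrightarrow> bounded_borel (B + C) (\<lambda>z. \<phi> z + \<psi> z)"
  unfolding bounded_borel_def by (auto intro!: order_trans[OF abs_triangle_ineq] add_mono)

lemma bounded_borel_diff:
  "bounded_borel B \<phi> \<Longrightarrow> bounded_borel C \<psi> \<Longrightarrow> bounded_borel (B + C) (\<lambda>z. \<phi> z - \<psi> z)"
  unfolding bounded_borel_def by (auto intro!: order_trans[OF abs_triangle_ineq4] add_mono)

lemma bounded_borel_cmult:
  "bounded_borel B \<phi> \<Longrightarrow> bounded_borel (\<bar>c\<bar> * B) (\<lambda>z. c * \<phi> z)"
  unfolding bounded_borel_def by (auto simp: abs_mult intro!: mult_left_mono)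

lemma bounded_borel_integrable:
  assumes "prob_space \<nu>" "sets \<nu> = sets borel" "bounded_borel B \<phi>"
  shows "integrable \<nu> \<phi>"
proof -
  interpret prob_space \<nu> by fact
  show ?thesis
    using assms(3) by (intro integrable_const_bound[where B=B])
      (auto simp: bounded_borel_def measurable_cong_sets[OF assms(2) refl])
qed

text \<open>The centre is the midpoint of supremum and infimum. Choosing a value of g instead would
  only give \<open>2 * D\<close>, and this factor would accumulate over the iterations.\<close>

lemma oscillation_center:
  fixes g :: "'a \<Rightarrow> real"
  assumes "\<And>z z'. \<bar>g z - g z'\<bar> \<le> 2 * D"
  obtains c where "\<And>z. \<bar>g z - c\<bar> \<le> D"
proof -
  have bdd: "g z \<le> g z' + 2 * D" "g z - 2 * D \<le> g z'" for z z'
    using assms[of z z'] by auto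
  have A: "bdd_above (range g)" "bdd_below (range g)" 
    using bdd by (auto intro!: bdd_aboveI bdd_belowI)
  have le: "g z \<le> (SUP z. g z)" "(INF z. g z) \<le> g z" for z
    using A by (auto intro: cSUP_upper cINF_lower)
  have "(SUP z. g z) - 2 * D \<le> g z'" for z'
    using cSUP_least[of UNIV g "g z' + 2 * D"] bdd by (simp add: diff_le_eq)
  then have "(SUP z. g z) - 2 * D \<le> (INF z. g z)" by (intro cINF_greatest) auto
  then have "\<bar>g z - ((SUP z. g z) + (INF z. g z)) / 2\<bar> \<le> D" for z
    using le[of z] by (simp add: abs_le_iff field_simps)
  then show ?thesis by (rule that)
qed

text \<open>Only the law of one noise variable is recorded: iterating the averaging operator already
  supplies fresh independent noise at each step.\<close>

locale random_map = prob_space N for N :: "'w measure" +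
  fixes T :: "'w \<Rightarrow> 'a::topological_space \<Rightarrow> 'a"
  assumes measurable_step: "(\<lambda>(w, z). T w z) \<in> N \<Otimes>\<^sub>M borel \<rightarrow>\<^sub>M borel"
begin

definition markov :: "('a \<Rightarrow> real) \<Rightarrow> 'a \<Rightarrow> real" where
  "markov \<phi> z = (\<integral>w. \<phi> (T w z) \<partial>N)"

lemma measurable_step_fst: "(\<lambda>w. T w z) \<in> N \<rightarrow>\<^sub>M borel"
  using measurable_compose[OF _ measurable_step, of "\<lambda>w. (w, z)" N] by simp

lemma measurable_observable:
  "\<phi> \<in> borel_measurable borel \<Longrightarrow> (\<lambda>w. \<phi> (T w z)) \<in> borel_measurable N"
  by (rule measurable_compose[OF measurable_step_fst])

lemma integrable_observable:
  "bounded_borel B \<phi> \<Longrightarrow> integrable N (\<lambda>w. \<phi> (T w z))"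
  by (intro integrable_const_bound[where B=B]) (auto simp: bounded_borel_def measurable_observable)

lemma bounded_borel_markov:
  assumes "bounded_borel B \<phi>"
  shows "bounded_borel B (markov \<phi>)"
  unfolding bounded_borel_def
proof (intro conjI allI)
  note [measurable] = bounded_borelD(1)[OF assms] measurable_step
  have "(\<lambda>(z, w). (\<lambda>(w, z). T w z) (w, z)) \<in> borel \<Otimes>\<^sub>M N \<rightarrow>\<^sub>M borel" by measurable
  then have [measurable]: "(\<lambda>(z, w). \<phi> (T w z)) \<in> borel_measurable (borel \<Otimes>\<^sub>M N)"
    using measurable_compose[OF _ bounded_borelD(1)[OF assms]] by (simp add: split_beta)
  show "markov \<phi> \<in> borel_measurable borel"
    unfolding markov_def by (rule borel_measurable_lebesgue_integral) simp
  fix z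
  have "\<bar>markov \<phi> z\<bar> \<le> (\<integral>w. \<bar>\<phi> (T w z)\<bar> \<partial>N)"
    unfolding markov_def by (rule integral_abs_bound)
  also have "\<dots> \<le> (\<integral>w. B \<partial>N)"
    using bounded_borelD(2)[OF assms] integrable_observable[OF assms, of z] by (intro integral_mono) auto
  finally show "\<bar>markov \<phi> z\<bar> \<le> B" by (simp add: prob_space)
qed

lemma markov_add:
  "bounded_borel B \<phi> \<Longrightarrow> bounded_borel C \<psi> \<Longrightarrow> markov (\<lambda>z. \<phi> z + \<psi> z) = (\<lambda>z. markov \<phi> z + markov \<psi> z)"
  by (auto simp: markov_def integrable_observable)

lemma markov_diff:
  "bounded_borel B \<phi> \<Longrightarrow> bounded_borel C \<psi> \<Longrightarrow> markov (\<lambda>z. \<phi> z - \<psi> z) = (\<lambda>z. markov \<phi> z - markov \<psi> z)"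
  by (auto simp: markov_def integrable_observable)

lemma markov_cmult: "markov (\<lambda>z. c * \<phi> z) = (\<lambda>z. c * markov \<phi> z)"
  by (auto simp: markov_def)

lemma markov_const: "markov (\<lambda>z. c) = (\<lambda>z. c)"
  by (auto simp: markov_def prob_space)

lemma markov_mono:
  assumes "bounded_borel B \<phi>" "bounded_borel C \<psi>" "\<And>z. \<phi> z \<le> \<psi> z"
  shows "markov \<phi> z \<le> markov \<psi> z"
  unfolding markov_def using assms by (intro integral_mono) (auto simp: integrable_observable)

lemma bounded_borel_markov_pow: "bounded_borel B \<phi> \<Longrightarrow> bounded_borel B ((markov ^^ n) \<phi>)"
  by (induction n) (auto intro: bounded_borel_markov)

lemma markov_pow_add:
  assumes "bounded_borel B \<phi>" "bounded_borel C \<psi>"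
  shows "(markov ^^ n) (\<lambda>z. \<phi> z + \<psi> z) = (\<lambda>z. (markov ^^ n) \<phi> z + (markov ^^ n) \<psi> z)"
  by (induction n)
    (simp_all add: markov_add[OF bounded_borel_markov_pow[OF assms(1)] bounded_borel_markov_pow[OF assms(2)]])

lemma markov_pow_diff:
  assumes "bounded_borel B \<phi>" "bounded_borel C \<psi>"
  shows "(markov ^^ n) (\<lambda>z. \<phi> z - \<psi> z) = (\<lambda>z. (markov ^^ n) \<phi> z - (markov ^^ n) \<psi> z)"
  by (induction n)
    (simp_all add: markov_diff[OF bounded_borel_markov_pow[OF assms(1)] bounded_borel_markov_pow[OF assms(2)]])

lemma markov_pow_cmult: "(markov ^^ n) (\<lambda>z. c * \<phi> z) = (\<lambda>z. c * (markov ^^ n) \<phi> z)"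
  by (induction n) (simp_all add: markov_cmult)

lemma markov_pow_const: "(markov ^^ n) (\<lambda>z. c) = (\<lambda>z. c)"
  by (induction n) (simp_all add: markov_const)

lemma markov_pow_mono:
  assumes "bounded_borel B \<phi>" "bounded_borel C \<psi>" "\<And>z. \<phi> z \<le> \<psi> z"
  shows "(markov ^^ n) \<phi> z \<le> (markov ^^ n) \<psi> z"
proof (induction n arbitrary: z)
  case (Suc n)
  show ?case
    by (simp, rule markov_mono) (use Suc assms bounded_borel_markov_pow in auto)
qed (simp add: assms)

text \<open>Dominated convergence, once per step. Together with the uniform rate this yields
  countable additivity of the limit functional.\<close>

lemma markov_pow_tendsto:
  assumes "\<And>i. bounded_borel B (\<phi> i)" "bounded_borel B \<psi>" "\<And>z. (\<lambda>i. \<phi> i z) \<longlonglongrightarrow> \<psi> z"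
  shows "(\<lambda>i. (markov ^^ n) (\<phi> i) z) \<longlonglongrightarrow> (markov ^^ n) \<psi> z"
proof (induction n arbitrary: z)
  case (Suc n)
  have "(\<lambda>i. \<integral>w. (markov ^^ n) (\<phi> i) (T w z) \<partial>N) \<longlonglongrightarrow> (\<integral>w. (markov ^^ n) \<psi> (T w z) \<partial>N)"
    using bounded_borel_markov_pow[OF assms(1), of n] bounded_borel_markov_pow[OF assms(2), of n] Suc
    by (intro integral_dominated_convergence[where w="\<lambda>_. B"])
      (auto simp: bounded_borel_def measurable_observable)
  then show ?case by (simp add: markov_def[of "(markov ^^ n) _"])
qed (simp add: assms)

end

section \<open>Geometric decay of the oscillation\<close>

locale contracting_random_map = random_map N T
  for N :: "'w measure" and T :: "'w \<Rightarrow> 'a::topological_space \<Rightarrow> 'a" +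
  fixes m :: nat and \<theta> :: real
  assumes m: "m > 0" and \<theta>: "0 \<le> \<theta>" "\<theta> < 1"
    and contraction:
      "\<And>B \<phi> z z'. bounded_borel B \<phi> \<Longrightarrow> \<bar>(markov ^^ m) \<phi> z - (markov ^^ m) \<phi> z'\<bar> \<le> 2 * (\<theta> * B)"
begin

text \<open>After each block of m steps the function is recentred: the contraction turns a bound
  \<open>\<theta> ^ k * B\<close> for the centred iterate into an oscillation of twice
  \<open>\<theta> ^ Suc k * B\<close>, and the midpoint halves it again. The remaining
  \<open>n mod m\<close> steps merely preserve the bound, hence \<open>n div m\<close>.\<close>

lemma markov_pow_center:
  assumes "bounded_borel B \<phi>"
  shows "\<exists>c. \<forall>z. \<bar>(markov ^^ n) \<phi> z - c\<bar> \<le> \<theta> ^ (n div m) * B"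
proof -
  have A: "\<exists>c. \<forall>z. \<bar>(markov ^^ (m * k)) \<phi> z - c\<bar> \<le> \<theta> ^ k * B" for k
  proof (induction k)
    case 0
    show ?case using bounded_borelD(2)[OF assms] by (auto intro: exI[of _ 0])
  next
    case (Suc k)
    then obtain c where c: "\<bar>(markov ^^ (m * k)) \<phi> z - c\<bar> \<le> \<theta> ^ k * B" for z by blast
    let ?\<psi> = "\<lambda>z. (markov ^^ (m * k)) \<phi> z - c"
    note b = bounded_borel_markov_pow[OF assms, of "m * k"]
    have "bounded_borel (\<theta> ^ k * B) ?\<psi>"
      using b c by (auto simp: bounded_borel_def)
    from contraction[OF this]
    have "\<bar>(markov ^^ m) ?\<psi> z - (markov ^^ m) ?\<psi> z'\<bar> \<le> 2 * (\<theta> ^ Suc k * B)" for z z'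
      by (simp add: mult.assoc)
    moreover have "(markov ^^ m) ?\<psi> = (\<lambda>z. (markov ^^ (m * Suc k)) \<phi> z - c)"
      using markov_pow_diff[OF b bounded_borel_const, of m c]
      by (simp add: markov_pow_const funpow_add)
    ultimately have "\<bar>(markov ^^ (m * Suc k)) \<phi> z - (markov ^^ (m * Suc k)) \<phi> z'\<bar> \<le> 2 * (\<theta> ^ Suc k * B)"
      for z z' by simp
    then obtain c where "\<bar>(markov ^^ (m * Suc k)) \<phi> z - c\<bar> \<le> \<theta> ^ Suc k * B" for z
      by (rule oscillation_center[of "(markov ^^ (m * Suc k)) \<phi>"]) blast
    then show ?case by blast
  qed
  obtain c where c: "\<bar>(markov ^^ (m * (n div m))) \<phi> z - c\<bar> \<le> \<theta> ^ (n div m) * B" for z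
    using A by blast
  let ?\<psi> = "\<lambda>z. (markov ^^ (m * (n div m))) \<phi> z - c"
  note b = bounded_borel_markov_pow[OF assms, of "m * (n div m)"]
  have "bounded_borel (\<theta> ^ (n div m) * B) ?\<psi>"
    using b c by (auto simp: bounded_borel_def)
  from bounded_borelD(2)[OF bounded_borel_markov_pow[OF this, of "n mod m"]]
  have "\<bar>(markov ^^ (n mod m)) ?\<psi> z\<bar> \<le> \<theta> ^ (n div m) * B" for z .
  moreover have "(markov ^^ (n mod m)) ?\<psi> = (\<lambda>z. (markov ^^ n) \<phi> z - c)"
    using markov_pow_diff[OF b bounded_borel_const, of "n mod m" c]
      funpow_add[of "n mod m" "m * (n div m)" markov]
    by (simp add: markov_pow_const fun_eq_iff)
  ultimately show ?thesis by auto
qed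

text \<open>Averaging \<open>(markov ^^ n) \<phi> - c\<close> further keeps its bound, so the
  iterates at times n and n + j lie near the same c. Allowing both the times and the points to
  differ gives the Cauchy property and the independence of the point at once.\<close>

lemma markov_pow_osc:
  assumes "bounded_borel B \<phi>"
  shows "\<bar>(markov ^^ (n + j)) \<phi> z - (markov ^^ n) \<phi> z'\<bar> \<le> 2 * \<theta> ^ (n div m) * B"
proof -
  obtain c where c: "\<bar>(markov ^^ n) \<phi> z - c\<bar> \<le> \<theta> ^ (n div m) * B" for z
    using markov_pow_center[OF assms] by blast
  let ?\<psi> = "\<lambda>z. (markov ^^ n) \<phi> z - c"
  note b = bounded_borel_markov_pow[OF assms, of n]
  have "bounded_borel (\<theta> ^ (n div m) * B) ?\<psi>"
    using b c by (auto simp: bounded_borel_def)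
  from bounded_borelD(2)[OF bounded_borel_markov_pow[OF this, of j], of z]
  have "\<bar>(markov ^^ (n + j)) \<phi> z - c\<bar> \<le> \<theta> ^ (n div m) * B"
    using markov_pow_diff[OF b bounded_borel_const, of j c] funpow_add[of j n markov]
    by (simp add: markov_pow_const add.commute)
  with c[of z'] show ?thesis by linarith
qed

lemma rate_tendsto_0: "(\<lambda>n. 2 * \<theta> ^ (n div m) * B) \<longlonglongrightarrow> 0"
proof -
  have "filterlim (\<lambda>n. n div m) sequentially sequentially"
    unfolding filterlim_at_top eventually_sequentially
  proof
    fix Z show "\<exists>N. \<forall>n\<ge>N. Z \<le> n div m"
      using m by (auto intro!: exI[of _ "Z * m"] simp: less_eq_div_iff_mult_less_eq)
  qed
  then have "(\<lambda>n. \<theta> ^ (n div m)) \<longlonglongrightarrow> 0"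
    using LIMSEQ_power_zero[of \<theta>] \<theta> by (auto intro: filterlim_compose)
  then have "(\<lambda>n. 2 * \<theta> ^ (n div m) * B) \<longlonglongrightarrow> 2 * 0 * B" by (intro tendsto_intros)
  then show ?thesis by simp
qed

section \<open>The limit functional of the iterates\<close>

text \<open>The point of evaluation is irrelevant: the oscillation of the iterates tends to 0.\<close>

definition mean :: "('a \<Rightarrow> real) \<Rightarrow> real" where
  "mean \<phi> = lim (\<lambda>n. (markov ^^ n) \<phi> undefined)"

lemma mean_tendsto_undefined:
  assumes "bounded_borel B \<phi>"
  shows "(\<lambda>n. (markov ^^ n) \<phi> undefined) \<longlonglongrightarrow> mean \<phi>"
proof -
  have "Cauchy (\<lambda>n. (markov ^^ n) \<phi> undefined)"
  proof (rule metric_CauchyI)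
    fix e :: real assume "0 < e"
    then obtain n where n: "2 * \<theta> ^ (n div m) * B < e / 2"
      using order_tendstoD(2)[OF rate_tendsto_0, of "e / 2" B] \<open>0 < e\<close>
      by (auto simp: eventually_sequentially)
    have near: "\<bar>(markov ^^ i) \<phi> undefined - (markov ^^ n) \<phi> undefined\<bar> < e / 2" if "i \<ge> n" for i
      using markov_pow_osc[OF assms, of n "i - n" undefined undefined] that n by simp
    have "dist ((markov ^^ i) \<phi> undefined) ((markov ^^ j) \<phi> undefined) < e"
      if "i \<ge> n" "j \<ge> n" for i j
      using that(1)[THEN near] that(2)[THEN near] unfolding dist_real_def by linarith
    then show "\<exists>M. \<forall>i\<ge>M. \<forall>j\<ge>M. dist ((markov ^^ i) \<phi> undefined) ((markov ^^ j) \<phi> undefined) < e"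
      by blast
  qed
  then show ?thesis
    unfolding mean_def by (simp add: Cauchy_convergent convergent_LIMSEQ_iff[symmetric])
qed

lemma mean_rate:
  assumes "bounded_borel B \<phi>"
  shows "\<bar>(markov ^^ n) \<phi> z - mean \<phi>\<bar> \<le> 2 * \<theta> ^ (n div m) * B"
proof (rule LIMSEQ_le_const2)
  have "(\<lambda>j. (markov ^^ (n + j)) \<phi> undefined) \<longlonglongrightarrow> mean \<phi>"
    using LIMSEQ_ignore_initial_segment[OF mean_tendsto_undefined[OF assms], of n]
    by (simp add: add.commute)
  then show "(\<lambda>j. \<bar>(markov ^^ n) \<phi> z - (markov ^^ (n + j)) \<phi> undefined\<bar>) \<longlonglongrightarrow> \<bar>(markov ^^ n) \<phi> z - mean \<phi>\<bar>"
    by (intro tendsto_intros)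
  show "\<exists>N. \<forall>j\<ge>N. \<bar>(markov ^^ n) \<phi> z - (markov ^^ (n + j)) \<phi> undefined\<bar> \<le> 2 * \<theta> ^ (n div m) * B"
    using markov_pow_osc[OF assms] by (simp add: abs_minus_commute)
qed

lemma mean_tendsto:
  assumes "bounded_borel B \<phi>"
  shows "(\<lambda>n. (markov ^^ n) \<phi> z) \<longlonglongrightarrow> mean \<phi>"
  by (rule LIM_zero_cancel, rule Lim_null_comparison[OF _ rate_tendsto_0[of B]])
    (use mean_rate[OF assms] in auto)

lemma mean_unique:
  assumes "bounded_borel B \<phi>" "\<And>n. (markov ^^ n) \<phi> undefined = f n" "f \<longlonglongrightarrow> c"
  shows "mean \<phi> = c"
  using mean_tendsto[OF assms(1), of undefined] assms(2,3) LIMSEQ_unique by simp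

lemma mean_add:
  assumes "bounded_borel B \<phi>" "bounded_borel C \<psi>"
  shows "mean (\<lambda>z. \<phi> z + \<psi> z) = mean \<phi> + mean \<psi>"
  by (rule mean_unique[OF bounded_borel_add[OF assms] _
        tendsto_add[OF mean_tendsto[OF assms(1)] mean_tendsto[OF assms(2)]]])
    (simp add: markov_pow_add[OF assms])

lemma mean_cmult:
  assumes "bounded_borel B \<phi>"
  shows "mean (\<lambda>z. c * \<phi> z) = c * mean \<phi>"
  by (rule mean_unique[OF bounded_borel_cmult[OF assms] _
        tendsto_mult_left[OF mean_tendsto_undefined[OF assms]]])
    (simp add: markov_pow_cmult)

lemma mean_const: "mean (\<lambda>z. c) = c"
  by (intro mean_unique[OF bounded_borel_const, of _ "\<lambda>_. c"]) (simp_all add: markov_pow_const)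

lemma mean_markov:
  assumes "bounded_borel B \<phi>"
  shows "mean (markov \<phi>) = mean \<phi>"
  by (rule mean_unique[OF bounded_borel_markov[OF assms] _ LIMSEQ_Suc[OF mean_tendsto[OF assms]]])
    (simp add: funpow_swap1)

lemma mean_nonneg:
  assumes "bounded_borel B \<phi>" "\<And>z. 0 \<le> \<phi> z"
  shows "0 \<le> mean \<phi>"
  using markov_pow_mono[OF bounded_borel_const[of 0] assms(1)] assms(2)
  by (intro LIMSEQ_le_const[OF mean_tendsto[OF assms(1), of undefined]]) (auto simp: markov_pow_const)

text \<open>An interchange of limits: the rate is uniform in i because all the functions share the
  bound B, so one n serves them all, and at that n the iterates converge by dominated
  convergence.\<close>

lemma mean_dominated:
  assumes "\<And>i. bounded_borel B (\<phi> i)" "bounded_borel B \<psi>" "\<And>z. (\<lambda>i. \<phi> i z) \<longlonglongrightarrow> \<psi> z"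
  shows "(\<lambda>i. mean (\<phi> i)) \<longlonglongrightarrow> mean \<psi>"
proof (rule LIMSEQ_I)
  fix e :: real assume "0 < e"
  then have "0 < e / 3" by simp
  from order_tendstoD(2)[OF rate_tendsto_0 this, of B]
  obtain n where n: "2 * \<theta> ^ (n div m) * B < e / 3" by (auto simp: eventually_sequentially)
  obtain k where k: "\<bar>(markov ^^ n) (\<phi> i) undefined - (markov ^^ n) \<psi> undefined\<bar> < e / 3" if "i \<ge> k" for i
    using LIMSEQ_D[OF markov_pow_tendsto[OF assms, of n undefined] \<open>0 < e / 3\<close>] by auto
  have "norm (mean (\<phi> i) - mean \<psi>) < e" if "i \<ge> k" for i
    using k[OF that] n mean_rate[OF assms(1), of n i undefined] mean_rate[OF assms(2), of n undefined]
    unfolding real_norm_def by linarith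
  then show "\<exists>k. \<forall>i\<ge>k. norm (mean (\<phi> i) - mean \<psi>) < e" by blast
qed

section \<open>The invariant measure\<close>

lemma bounded_borel_indicator: "A \<in> sets borel \<Longrightarrow> bounded_borel 1 (indicator A)"
  by (auto simp: bounded_borel_def indicator_def)

definition invariant :: "'a measure" where
  "invariant = measure_of UNIV (sets borel) (\<lambda>A. ennreal (mean (indicator A)))"

lemma sets_invariant: "sets invariant = sets borel"
  unfolding invariant_def by (metis sets.sigma_sets_eq sets_measure_of sets.space_closed space_borel)

text \<open>\<open>measure_of\<close> returns the intended set function only once that is known to
  be a measure. Additivity comes from linearity of \<open>mean\<close>, and continuity at the empty
  set from \<open>mean_dominated\<close> applied to decreasing indicators.\<close>

lemma emeasure_invariant:
  assumes "A \<in> sets borel"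
  shows "emeasure invariant A = ennreal (mean (indicator A))"
proof -
  interpret ring_of_sets "UNIV :: 'a set" "sets borel"
    using sets.ring_of_sets_axioms[of borel] by simp
  let ?\<mu> = "\<lambda>A. ennreal (mean (indicator A))"
  have pos: "positive (sets borel) ?\<mu>"
    using mean_const[of 0] by (simp add: positive_def indicator_def[abs_def])
  have "additive (sets borel) ?\<mu>"
    unfolding additive_def
  proof (intro ballI impI)
    fix A B :: "'a set" assume A: "A \<in> sets borel" "B \<in> sets borel" "A \<inter> B = {}"
    have "indicator (A \<union> B) = (\<lambda>z. indicator A z + indicator B z :: real)"
      using A(3) by (auto simp: indicator_def fun_eq_iff)
    then have "mean (indicator (A \<union> B)) = mean (indicator A) + mean (indicator B)"
      using mean_add[OF bounded_borel_indicator[OF A(1)] bounded_borel_indicator[OF A(2)]] by simp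
    then show "?\<mu> (A \<union> B) = ?\<mu> A + ?\<mu> B"
      using A by (simp add: ennreal_plus mean_nonneg[OF bounded_borel_indicator])
  qed
  then have "countably_additive (sets borel) ?\<mu>"
  proof (rule empty_continuous_imp_countably_additive[OF pos])
    show "\<forall>A\<in>sets borel. ?\<mu> A \<noteq> \<infinity>" by simp
    fix A :: "nat \<Rightarrow> 'a set" assume A: "range A \<subseteq> sets borel" "decseq A" "(\<Inter>i. A i) = {}"
    have "(\<lambda>i. mean (indicator (A i))) \<longlonglongrightarrow> mean (\<lambda>z. 0)"
    proof (rule mean_dominated[where B=1])
      show "bounded_borel 1 (indicator (A i))" for i using A(1) by (intro bounded_borel_indicator) auto
      show "bounded_borel 1 (\<lambda>z. 0)" by (simp add: bounded_borel_def)
      show "(\<lambda>i. indicator (A i) z :: real) \<longlonglongrightarrow> 0" for z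
        using LIMSEQ_indicator_decseq[OF A(2), of z] A(3) by simp
    qed
    then show "(\<lambda>i. ?\<mu> (A i)) \<longlonglongrightarrow> 0"
      using mean_const[of 0] tendsto_ennrealI by force
  qed
  from emeasure_measure_of_sigma[OF _ pos this assms] show ?thesis
    unfolding invariant_def using sets.sigma_algebra_axioms[of "borel :: 'a measure"] by simp
qed

lemma prob_space_invariant: "prob_space invariant"
proof
  have "space invariant = UNIV" using sets_eq_imp_space_eq[OF sets_invariant] by simp
  then show "emeasure invariant (space invariant) = 1"
    using mean_const[of 1] by (simp add: emeasure_invariant indicator_def[abs_def])
qed

text \<open>The induction runs over all nonnegative measurable functions, bounded or not, so the
  bound is quantified inside the formula: in each case the parts inherit boundedness from the whole
  because everything is nonnegative.\<close>

lemma integral_invariant_nonneg: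
  assumes "\<phi> \<in> borel_measurable borel" "\<And>z. 0 \<le> \<phi> z"
  shows "\<forall>B. bounded_borel B \<phi> \<longrightarrow> integral\<^sup>L invariant \<phi> = mean \<phi>"
  using assms
proof (induction rule: borel_measurable_induct_real)
  case (set A)
  then show ?case
    by (simp add: measure_def emeasure_invariant sets_invariant mean_nonneg[OF bounded_borel_indicator])
next
  case (mult u c)
  show ?case
  \<comment> \<open>For c = 0 a bound on the product says nothing about u, so the induction
    hypothesis is unusable and the zero function is treated directly.\<close>
  proof (cases "c = 0")
    case False
    show ?thesis
    proof (intro allI impI)
      fix B assume "bounded_borel B (\<lambda>z. c * u z)"
      then have "bounded_borel (\<bar>1 / c\<bar> * B) (\<lambda>z. 1 / c * (c * u z))" by (rule bounded_borel_cmult)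
      then have "bounded_borel (\<bar>1 / c\<bar> * B) u" using False by simp
      then show "(\<integral>z. c * u z \<partial>invariant) = mean (\<lambda>z. c * u z)"
        using mult mean_cmult[of _ u c] by auto
    qed
  qed (simp add: mean_const)
next
  case (add u v)
  show ?case
  proof (intro allI impI)
    fix B assume "bounded_borel B (\<lambda>z. v z + u z)"
    then have b: "bounded_borel B u" "bounded_borel B v"
      using add by (auto simp: bounded_borel_def abs_le_iff) (smt (verit))+
    note i = bounded_borel_integrable[OF prob_space_invariant sets_invariant]
    show "(\<integral>z. v z + u z \<partial>invariant) = mean (\<lambda>z. v z + u z)"
      using add.IH b i[OF b(1)] i[OF b(2)] mean_add[OF b(2,1)] by auto
  qed
next
  case (seq U)
  show ?case
  proof (intro allI impI)
    fix B assume b: "bounded_borel B \<phi>"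
    interpret inv: prob_space invariant by (rule prob_space_invariant)
    have le: "U i z \<le> \<phi> z" for i z
      using seq.hyps(3,4) by (intro incseq_le) (auto simp: incseq_def le_fun_def)
    have bU: "bounded_borel B (U i)" for i
      using seq.hyps(1,2) le b unfolding bounded_borel_def
      by (metis abs_of_nonneg order_trans)
    have "(\<lambda>i. mean (U i)) \<longlonglongrightarrow> mean \<phi>"
      using seq.hyps(4) by (intro mean_dominated[OF bU b]) simp
    moreover have "(\<lambda>i. integral\<^sup>L invariant (U i)) \<longlonglongrightarrow> integral\<^sup>L invariant \<phi>"
      using seq.hyps(4) bU b by (intro integral_dominated_convergence[where w="\<lambda>_. B"])
        (auto simp: bounded_borel_def measurable_cong_sets[OF sets_invariant refl])
    moreover have "integral\<^sup>L invariant (U i) = mean (U i)" for i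
      using seq.IH bU by blast
    ultimately show "integral\<^sup>L invariant \<phi> = mean \<phi>" using LIMSEQ_unique by simp
  qed
qed

lemma integral_invariant:
  assumes "bounded_borel B \<phi>"
  shows "integral\<^sup>L invariant \<phi> = mean \<phi>"
proof -
  interpret inv: prob_space invariant by (rule prob_space_invariant)
  \<comment> \<open>Adding the bound B reduces a signed observable to a nonnegative one.\<close>
  have b: "bounded_borel (B + \<bar>B\<bar>) (\<lambda>z. \<phi> z + B)"
    by (rule bounded_borel_add[OF assms bounded_borel_const])
  have "0 \<le> \<phi> z + B" for z using bounded_borelD(2)[OF assms, of z] by linarith
  then have "(\<integral>z. \<phi> z + B \<partial>invariant) = mean (\<lambda>z. \<phi> z + B)"
    using integral_invariant_nonneg b by (blast dest: bounded_borelD(1))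
  then show ?thesis
    using mean_add[OF assms bounded_borel_const[of B]]
      bounded_borel_integrable[OF prob_space_invariant sets_invariant assms]
    by (simp add: mean_const inv.prob_space)
qed

section \<open>Uniqueness, ergodicity and mixing\<close>

theorem invariant_rate:
  "bounded_borel B \<phi> \<Longrightarrow> \<bar>(markov ^^ n) \<phi> z - integral\<^sup>L invariant \<phi>\<bar> \<le> 2 * \<theta> ^ (n div m) * B"
  by (simp add: integral_invariant mean_rate)

theorem integral_invariant_markov:
  "bounded_borel B \<phi> \<Longrightarrow> integral\<^sup>L invariant (markov \<phi>) = integral\<^sup>L invariant \<phi>"
  using bounded_borel_markov[of B \<phi>] by (simp add: integral_invariant mean_markov)

text \<open>Stationarity makes the integrals of the iterates of an indicator constant in n, while
  the iterates themselves converge to the constant \<open>mean (indicator A)\<close>.\<close>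

theorem invariant_unique:
  assumes \<nu>: "prob_space \<nu>" "sets \<nu> = sets borel"
    and st: "\<And>B \<phi>. bounded_borel B \<phi> \<Longrightarrow> integral\<^sup>L \<nu> (markov \<phi>) = integral\<^sup>L \<nu> \<phi>"
  shows "\<nu> = invariant"
proof (rule measure_eqI)
  interpret \<nu>: prob_space \<nu> by fact
  show "sets \<nu> = sets invariant" using \<nu> sets_invariant by simp
  fix A assume "A \<in> sets \<nu>"
  then have A: "A \<in> sets borel" using \<nu> by simp
  note b = bounded_borel_indicator[OF A]
  have pow: "integral\<^sup>L \<nu> ((markov ^^ n) (indicator A)) = measure \<nu> A" for n
  proof (induction n)
    case (Suc n)
    then show ?case using st[OF bounded_borel_markov_pow[OF b, of n]] by simp
  qed (use \<open>A \<in> sets \<nu>\<close> in simp)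
  have "(\<lambda>n. integral\<^sup>L \<nu> ((markov ^^ n) (indicator A))) \<longlonglongrightarrow> (\<integral>z. mean (indicator A) \<partial>\<nu>)"
    using mean_tendsto[OF b] bounded_borel_markov_pow[OF b]
    by (intro integral_dominated_convergence[where w="\<lambda>_. 1"])
      (auto simp: bounded_borel_def measurable_cong_sets[OF \<nu>(2) refl])
  then have "measure \<nu> A = mean (indicator A)"
    unfolding pow by (simp add: \<nu>.prob_space LIMSEQ_const_iff)
  then show "emeasure \<nu> A = emeasure invariant A"
    using A by (simp add: emeasure_invariant \<nu>.emeasure_eq_measure)
qed

text \<open>Invariance holds only almost everywhere, so it cannot be iterated pointwise.
  Stationarity applied to |f| shows that averaging maps almost everywhere vanishing functions to
  such functions; hence all iterates agree with \<phi> off one null set, where they also converge to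
  the mean.\<close>

theorem invariant_ergodic:
  assumes b: "bounded_borel B \<phi>" and inv: "AE z in invariant. markov \<phi> z = \<phi> z"
  shows "AE z in invariant. \<phi> z = mean \<phi>"
proof -
  note int = bounded_borel_integrable[OF prob_space_invariant sets_invariant]
  have zero: "AE z in invariant. markov f z = 0"
    if f: "bounded_borel C f" and ae: "AE z in invariant. f z = 0" for C f
  proof -
    have f': "bounded_borel C (\<lambda>z. \<bar>f z\<bar>)" using f by (auto simp: bounded_borel_def)
    have "integral\<^sup>L invariant (markov (\<lambda>z. \<bar>f z\<bar>)) = (\<integral>z. \<bar>f z\<bar> \<partial>invariant)"
      by (rule integral_invariant_markov[OF f'])
    also have "\<dots> = (\<integral>z. 0 \<partial>invariant)"
      using ae f' by (intro integral_cong_AE)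
        (auto simp: bounded_borel_def measurable_cong_sets[OF sets_invariant refl])
    finally have "integral\<^sup>L invariant (markov (\<lambda>z. \<bar>f z\<bar>)) = 0" by simp
    then have "AE z in invariant. markov (\<lambda>z. \<bar>f z\<bar>) z = 0"
      using integral_nonneg_eq_0_iff_AE[OF int[OF bounded_borel_markov[OF f']]]
      by (auto simp: markov_def)
    moreover have "\<bar>markov f z\<bar> \<le> markov (\<lambda>z. \<bar>f z\<bar>) z" for z
      unfolding markov_def by (rule integral_abs_bound)
    ultimately show ?thesis by (auto elim!: eventually_mono) (metis abs_le_zero_iff)
  qed
  have "AE z in invariant. (markov ^^ n) \<phi> z = \<phi> z" for n
  proof (induction n)
    case (Suc n)
    let ?f = "\<lambda>z. (markov ^^ n) \<phi> z - \<phi> z"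
    note b' = bounded_borel_markov_pow[OF b, of n]
    have "AE z in invariant. markov ?f z = 0"
      using Suc by (intro zero[OF bounded_borel_diff[OF b' b]]) auto
    then show ?case using inv by eventually_elim (simp add: markov_diff[OF b' b])
  qed simp
  then have "AE z in invariant. \<forall>n. (markov ^^ n) \<phi> z = \<phi> z" by (simp add: AE_all_countable)
  then show ?thesis
  proof eventually_elim
    case (elim z)
    then show ?case using mean_tendsto[OF b, of z] by (simp add: LIMSEQ_const_iff)
  qed
qed

theorem invariant_mixing:
  assumes b: "bounded_borel B \<phi>" "bounded_borel C \<psi>"
  shows "(\<lambda>n. \<integral>z. (markov ^^ n) \<phi> z * \<psi> z \<partial>invariant)
    \<longlonglongrightarrow> integral\<^sup>L invariant \<phi> * integral\<^sup>L invariant \<psi>"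
proof -
  interpret inv: prob_space invariant by (rule prob_space_invariant)
  have "(\<lambda>n. \<integral>z. (markov ^^ n) \<phi> z * \<psi> z \<partial>invariant) \<longlonglongrightarrow> (\<integral>z. mean \<phi> * \<psi> z \<partial>invariant)"
  proof (rule integral_dominated_convergence[where w="\<lambda>_. B * C"])
    show "AE z in invariant. (\<lambda>n. (markov ^^ n) \<phi> z * \<psi> z) \<longlonglongrightarrow> mean \<phi> * \<psi> z"
      by (intro AE_I2 tendsto_mult_right mean_tendsto[OF b(1)])
    show "AE z in invariant. norm ((markov ^^ n) \<phi> z * \<psi> z) \<le> B * C" for n
      using bounded_borelD(2)[OF bounded_borel_markov_pow[OF b(1), of n]] bounded_borelD(2)[OF b(2)]
        bounded_borel_nonneg[OF b(1)]
      by (auto simp: abs_mult intro!: mult_mono)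
  qed (use b bounded_borel_markov_pow[OF b(1)] in
      \<open>auto simp: bounded_borel_def measurable_cong_sets[OF sets_invariant refl]
        intro!: borel_measurable_times\<close>)
  then show ?thesis by (simp add: integral_invariant[OF b(1)])
qed

end

section \<open>Shifting the fast variable\<close>

lemma set_integrable_Icc_bounded:
  fixes g :: "real \<Rightarrow> real"
  assumes [measurable]: "g \<in> borel_measurable borel" and B: "\<And>x. x \<in> {a..b} \<Longrightarrow> \<bar>g x\<bar> \<le> B"
  shows "set_integrable lborel {a..b} g"
  unfolding set_integrable_def
proof (rule Bochner_Integration.integrable_bound)
  show "integrable lborel (\<lambda>x. B * indicator {a..b} x)"
    by (cases "a \<le> b") auto
  show "AE x in lborel. norm (indicator {a..b} x *\<^sub>R g x) \<le> norm (B * indicator {a..b} x)"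
    using B by (intro AE_I2) (auto simp: indicator_def intro: order_trans[OF _ abs_ge_self])
qed simp

lemma set_integral_Icc_bound:
  fixes g :: "real \<Rightarrow> real"
  assumes [measurable]: "g \<in> borel_measurable borel" and B: "\<And>x. x \<in> {a..b} \<Longrightarrow> \<bar>g x\<bar> \<le> B"
    and "a \<le> b"
  shows "\<bar>LBINT x:{a..b}. g x\<bar> \<le> B * (b - a)"
proof -
  have "\<bar>LBINT x:{a..b}. g x\<bar> \<le> (\<integral>x. \<bar>indicator {a..b} x *\<^sub>R g x\<bar> \<partial>lborel)"
    unfolding set_lebesgue_integral_def by (rule integral_abs_bound)
  also have "\<dots> \<le> (\<integral>x. B * indicator {a..b} x \<partial>lborel)"
  proof (rule integral_mono)
    show "integrable lborel (\<lambda>x. \<bar>indicator {a..b} x *\<^sub>R g x\<bar>)"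
      using set_integrable_Icc_bounded[OF assms(1,2)] unfolding set_integrable_def
      by (rule integrable_abs)
    show "integrable lborel (\<lambda>x. B * indicator {a..b} x)" using \<open>a \<le> b\<close> by simp
  qed (use B in \<open>auto simp: indicator_def\<close>)
  also have "\<dots> = B * (b - a)" using \<open>a \<le> b\<close> by simp
  finally show ?thesis .
qed

lemma set_integral_Icc_combine:
  fixes g :: "real \<Rightarrow> real"
  assumes "g \<in> borel_measurable borel" "\<And>x. x \<in> {a..b} \<Longrightarrow> \<bar>g x\<bar> \<le> B" "a \<le> m" "m \<le> b"
  shows "(LBINT x:{a..b}. g x) = (LBINT x:{a..m}. g x) + (LBINT x:{m..b}. g x)"
proof -
  have "{a..b} = {a..m} \<union> {m..b}" using assms by auto
  moreover have "AE x in lborel. \<not> (x \<in> {a..m} \<and> x \<in> {m..b})"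
    using AE_lborel_singleton[of m] by eventually_elim auto
  moreover have "set_integrable lborel {a..m} g" "set_integrable lborel {m..b} g"
    using assms by (auto intro!: set_integrable_Icc_bounded[where B=B])
  ultimately show ?thesis by (simp add: set_integral_Un_AE)
qed

lemma borel_measurable_case_prod_compose:
  assumes "case_prod H \<in> borel_measurable (borel \<Otimes>\<^sub>M borel)"
    and "f \<in> borel_measurable M" "g \<in> borel_measurable M"
  shows "(\<lambda>x. H (f x) (g x)) \<in> borel_measurable M"
  using measurable_compose[OF measurable_Pair[OF assms(2,3)] assms(1)] by simp

section \<open>Monotone branches of the sine\<close>

text \<open>The derivative \<open>cos t - 1 / 2\<close> is nonnegative up to \<open>pi / 3\<close>.
  With \<open>x = 2 * pi * \<kappa>\<close> this range is the origin of the recurring condition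
  \<open>\<kappa> \<le> 1 / 6\<close>.\<close>

lemma sin_ge_half:
  fixes x :: real
  assumes "0 \<le> x" "x \<le> pi / 3"
  shows "x / 2 \<le> sin x"
proof -
  have "(\<lambda>x. sin x - x / 2) 0 \<le> (\<lambda>x. sin x - x / 2) x"
  proof (rule DERIV_nonneg_imp_nondecreasing[OF assms(1)])
    fix t assume t: "0 \<le> t" "t \<le> x"
    have "cos (pi / 3) \<le> cos t" using t assms by (intro cos_monotone_0_pi_le) auto
    then have "0 \<le> cos t - 1 / 2" by (simp add: cos_60)
    moreover have "((\<lambda>x. sin x - x / 2) has_real_derivative cos t - 1 / 2) (at t)"
      by (auto intro!: derivative_eq_intros)
    ultimately show "\<exists>y. ((\<lambda>x. sin x - x / 2) has_real_derivative y) (at t) \<and> 0 \<le> y" by blast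
  qed
  then show ?thesis by simp
qed

lemma cos_2pi_ge:
  assumes \<kappa>: "0 < \<kappa>" "\<kappa> \<le> 1 / 6" and u: "\<bar>u\<bar> \<le> 1 / 4 - \<kappa>"
  shows "\<kappa> \<le> cos (2 * pi * u)"
proof -
  have "1 * \<kappa> \<le> pi * \<kappa>" using pi_gt3 \<kappa> by (intro mult_right_mono) auto
  then have "\<kappa> \<le> (2 * pi * \<kappa>) / 2" by simp
  also have "\<dots> \<le> sin (2 * pi * \<kappa>)" using \<kappa> by (intro sin_ge_half) (auto simp: field_simps)
  also have "\<dots> = cos (2 * pi * (1 / 4 - \<kappa>))" using cos_sin_eq[of "2 * pi * (1 / 4 - \<kappa>)"]
    by (simp add: algebra_simps)
  also have "\<dots> \<le> cos (2 * pi * \<bar>u\<bar>)"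
    using \<kappa> by (intro cos_monotone_0_pi_le mult_left_mono[OF u]) (auto simp: algebra_simps add_increasing2)
  also have "\<dots> = cos (2 * pi * u)" using cos_abs_real[of "2 * pi * u"] by (simp add: abs_mult)
  finally show ?thesis .
qed

text \<open>The inverse of \<open>sin (2 * pi * u)\<close> on the branch around 0, with angles
  measured in turns; \<open>arcsin_turn'\<close> is its derivative, the density that the
  substitution \<open>t = sin (2 * pi * u)\<close> produces.\<close>

definition arcsin_turn :: "real \<Rightarrow> real" where
  "arcsin_turn t = arcsin t / (2 * pi)"

definition arcsin_turn' :: "real \<Rightarrow> real" where
  "arcsin_turn' t = inverse (sqrt (1 - t\<^sup>2)) / (2 * pi)"

text \<open>The condition \<open>\<kappa>\<^sup>2 \<le> 1 - t\<^sup>2\<close> says that an angle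
  with sine t has a cosine of modulus at least \<kappa>: it describes the core of a branch, away
  from the critical values 1 and -1.\<close>

lemma abs_less_1_core: "0 < \<kappa> \<Longrightarrow> \<kappa>\<^sup>2 \<le> 1 - t\<^sup>2 \<Longrightarrow> \<bar>t\<bar> < (1::real)"
  by (metis abs_square_less_1 diff_gt_0_iff_gt less_le_trans zero_less_power)

lemma arcsin_turn'_bounds:
  assumes "0 < \<kappa>" "\<kappa>\<^sup>2 \<le> 1 - t\<^sup>2"
  shows "0 \<le> arcsin_turn' t" "arcsin_turn' t \<le> 1 / \<kappa>" "inverse (sqrt (1 - t\<^sup>2)) \<le> 1 / \<kappa>"
proof -
  have "\<kappa> \<le> sqrt (1 - t\<^sup>2)" using assms by (simp add: real_le_rsqrt)
  then show *: "inverse (sqrt (1 - t\<^sup>2)) \<le> 1 / \<kappa>"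
    using assms(1) by (simp add: inverse_eq_divide frac_le)
  have "0 \<le> sqrt (1 - t\<^sup>2)" using \<open>\<kappa> \<le> sqrt (1 - t\<^sup>2)\<close> assms(1) by linarith
  then have pos: "0 \<le> inverse (sqrt (1 - t\<^sup>2))" by (simp only: inverse_nonnegative_iff_nonnegative)
  then show "0 \<le> arcsin_turn' t" by (simp add: arcsin_turn'_def)
  have "arcsin_turn' t \<le> inverse (sqrt (1 - t\<^sup>2)) / 1"
    unfolding arcsin_turn'_def using pos pi_gt3 by (intro divide_left_mono) auto
  with * show "arcsin_turn' t \<le> 1 / \<kappa>" by simp
qed

lemma has_derivative_arcsin_turn:
  assumes "\<bar>t\<bar> < 1"
  shows "(arcsin_turn has_real_derivative arcsin_turn' t) (at t)"
  using DERIV_cdivide[OF DERIV_arcsin, of t "2 * pi"] assms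
  unfolding arcsin_turn_def[abs_def] arcsin_turn'_def by (simp add: abs_less_iff)

lemma has_derivative_arcsin_turn':
  assumes "\<bar>t\<bar> < 1"
  shows "(arcsin_turn' has_real_derivative t * inverse (sqrt (1 - t\<^sup>2)) ^ 3 / (2 * pi)) (at t)"
proof -
  have pos: "0 < 1 - t\<^sup>2" using assms by (simp add: abs_square_less_1)
  then show ?thesis
    unfolding arcsin_turn'_def[abs_def]
    by (auto intro!: derivative_eq_intros simp: field_simps power2_eq_square power3_eq_cube)
qed

text \<open>The core is a symmetric interval, so mean value estimates apply on it.\<close>

lemma convex_core: "convex {t::real. \<kappa>\<^sup>2 \<le> 1 - t\<^sup>2}"
proof -
  have "\<kappa>\<^sup>2 \<le> 1 - t\<^sup>2 \<longleftrightarrow> \<bar>t\<bar> \<le> sqrt (1 - \<kappa>\<^sup>2)" for t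
    by (simp only: real_sqrt_abs[symmetric] real_sqrt_le_iff) linarith
  moreover have "{t::real. \<bar>t\<bar> \<le> r} = {- r..r}" for r by auto
  ultimately show ?thesis by simp
qed

text \<open>The second derivative of arcsin is of size \<open>(1 - t\<^sup>2)\<close> to the power
  -3/2. This is the source of \<open>\<kappa> ^ 3\<close> in all error terms.\<close>

lemma arcsin_turn_lipschitz:
  assumes "0 < \<kappa>" "\<kappa>\<^sup>2 \<le> 1 - t\<^sup>2" "\<kappa>\<^sup>2 \<le> 1 - t'\<^sup>2"
  shows "\<bar>arcsin_turn t - arcsin_turn t'\<bar> \<le> 1 / \<kappa> * \<bar>t - t'\<bar>"
    "\<bar>arcsin_turn' t - arcsin_turn' t'\<bar> \<le> 1 / \<kappa> ^ 3 * \<bar>t - t'\<bar>"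
proof -
  let ?S = "{t::real. \<kappa>\<^sup>2 \<le> 1 - t\<^sup>2}"
  show "\<bar>arcsin_turn t - arcsin_turn t'\<bar> \<le> 1 / \<kappa> * \<bar>t - t'\<bar>"
    using arcsin_turn'_bounds[OF assms(1)] abs_less_1_core[OF assms(1)] assms
    by (intro field_differentiable_bound[of ?S arcsin_turn arcsin_turn', unfolded real_norm_def]
        has_field_derivative_at_within[OF has_derivative_arcsin_turn] convex_core) auto
  have "\<bar>t * inverse (sqrt (1 - t\<^sup>2)) ^ 3 / (2 * pi)\<bar> \<le> 1 / \<kappa> ^ 3" if t: "t \<in> ?S" for t
  proof -
    have i: "0 \<le> inverse (sqrt (1 - t\<^sup>2))" "inverse (sqrt (1 - t\<^sup>2)) \<le> 1 / \<kappa>"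
      using arcsin_turn'_bounds[OF assms(1), of t] t abs_less_1_core[OF assms(1), of t]
      by (auto simp: abs_square_le_1)
    have "\<bar>t * inverse (sqrt (1 - t\<^sup>2)) ^ 3 / (2 * pi)\<bar> = \<bar>t\<bar> * inverse (sqrt (1 - t\<^sup>2)) ^ 3 / (2 * pi)"
      using i(1) by (simp add: abs_mult)
    also have "\<dots> \<le> 1 * (1 / \<kappa>) ^ 3 / 1"
      using i t abs_less_1_core[OF assms(1), of t] pi_gt3 assms(1)
      by (intro frac_le mult_mono power_mono) auto
    finally show ?thesis by (simp add: power_one_over)
  qed
  then show "\<bar>arcsin_turn' t - arcsin_turn' t'\<bar> \<le> 1 / \<kappa> ^ 3 * \<bar>t - t'\<bar>"
    using abs_less_1_core[OF assms(1)] assms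
    by (intro field_differentiable_bound[of ?S arcsin_turn'
          "\<lambda>t. t * inverse (sqrt (1 - t\<^sup>2)) ^ 3 / (2 * pi)", unfolded real_norm_def]
        has_field_derivative_at_within[OF has_derivative_arcsin_turn'] convex_core) auto
qed

lemma sin_core:
  assumes \<kappa>: "0 < \<kappa>" "\<kappa> \<le> 1 / 6" and u: "\<bar>u\<bar> \<le> 1 / 4 - \<kappa>"
  shows "\<kappa>\<^sup>2 \<le> 1 - (sin (2 * pi * u))\<^sup>2" "arcsin_turn (sin (2 * pi * u)) = u"
proof -
  have "\<kappa>\<^sup>2 \<le> (cos (2 * pi * u))\<^sup>2" using cos_2pi_ge[OF assms] \<kappa> by (intro power_mono) auto
  then show "\<kappa>\<^sup>2 \<le> 1 - (sin (2 * pi * u))\<^sup>2" by (simp add: cos_squared_eq)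
  have "pi * \<bar>u\<bar> \<le> pi * (1 / 4)" using u \<kappa> by (intro mult_left_mono) auto
  then have "\<bar>pi * u\<bar> \<le> pi / 4" by (simp add: abs_mult)
  then have "- (pi / 2) \<le> 2 * pi * u" "2 * pi * u \<le> pi / 2" by linarith+
  then show "arcsin_turn (sin (2 * pi * u)) = u" by (simp add: arcsin_turn_def arcsin_sin)
qed

text \<open>The sine is recentred at c, so the substitution is increasing on every branch; the
  orientation of the branch is restored by the sign in \<open>branch_sin\<close>.\<close>

lemma branch_substitution:
  fixes F :: "real \<Rightarrow> real"
  assumes [measurable]: "F \<in> borel_measurable borel" and B: "\<And>u. \<bar>F u\<bar> \<le> B"
    and \<kappa>: "0 < \<kappa>" "\<kappa> \<le> 1 / 6" and ab: "c - 1 / 4 + \<kappa> \<le> a" "a \<le> b" "b \<le> c + 1 / 4 - \<kappa>"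
  defines "J \<equiv> {sin (2 * pi * (a - c)) .. sin (2 * pi * (b - c))}"
  shows "(LBINT u:{a..b}. F u) = (LBINT t:J. F (c + arcsin_turn t) * arcsin_turn' t)"
    and "set_integrable lborel J (\<lambda>t. F (c + arcsin_turn t) * arcsin_turn' t)"
    and "\<And>t. t \<in> J \<Longrightarrow> \<kappa>\<^sup>2 \<le> 1 - t\<^sup>2"
    and "sin (2 * pi * (a - c)) \<le> sin (2 * pi * (b - c))"
proof -
  let ?\<alpha> = "sin (2 * pi * (a - c))" and ?\<beta> = "sin (2 * pi * (b - c))"
  have a: "\<bar>a - c\<bar> \<le> 1 / 4 - \<kappa>" and b: "\<bar>b - c\<bar> \<le> 1 / 4 - \<kappa>" using ab by auto
  note sa = sin_core[OF \<kappa> a] and sb = sin_core[OF \<kappa> b]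
  have "?\<alpha> \<in> {t. \<kappa>\<^sup>2 \<le> 1 - t\<^sup>2}" "?\<beta> \<in> {t. \<kappa>\<^sup>2 \<le> 1 - t\<^sup>2}" using sa sb by auto
  then have "closed_segment ?\<alpha> ?\<beta> \<subseteq> {t. \<kappa>\<^sup>2 \<le> 1 - t\<^sup>2}"
    using convex_core by (rule closed_segment_subset)
  moreover have "pi * \<bar>a - c\<bar> \<le> pi * (1 / 4)" "pi * \<bar>b - c\<bar> \<le> pi * (1 / 4)" "pi * (a - c) \<le> pi * (b - c)"
    using a b \<kappa> ab by (auto intro!: mult_left_mono)
  then have "\<bar>pi * (a - c)\<bar> \<le> pi / 4" "\<bar>pi * (b - c)\<bar> \<le> pi / 4" "pi * (a - c) \<le> pi * (b - c)"
    by (auto simp: abs_mult)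
  then show le: "?\<alpha> \<le> ?\<beta>" by (intro sin_monotone_2pi_le) linarith+
  ultimately show core: "\<And>t. t \<in> J \<Longrightarrow> \<kappa>\<^sup>2 \<le> 1 - t\<^sup>2"
    by (auto simp: J_def closed_segment_eq_real_ivl)
  let ?g = "\<lambda>t. c + arcsin_turn t"
  have g: "?g ?\<alpha> = a" "?g ?\<beta> = b" using sa sb by auto
  have int: "set_integrable lborel {?g ?\<alpha>..?g ?\<beta>} F"
    by (rule set_integrable_Icc_bounded[where B=B]) (auto simp: B)
  have der: "(?g has_real_derivative arcsin_turn' t) (at t)" if "t \<in> {?\<alpha>..?\<beta>}" for t
    using has_derivative_arcsin_turn[of t] abs_less_1_core[OF \<kappa>(1) core[of t]] that
    by (auto simp: J_def intro!: derivative_eq_intros)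
  have cont: "continuous_on {?\<alpha>..?\<beta>} arcsin_turn'"
    using has_derivative_arcsin_turn' abs_less_1_core[OF \<kappa>(1) core]
    by (intro has_real_derivative_imp_continuous_on[of _ _ "\<lambda>t. t * inverse (sqrt (1 - t\<^sup>2)) ^ 3 / (2 * pi)"])
      (auto simp: J_def)
  have nn: "0 \<le> arcsin_turn' t" if "t \<in> {?\<alpha>..?\<beta>}" for t
    using arcsin_turn'_bounds(1)[OF \<kappa>(1) core[of t]] that by (simp add: J_def)
  note sub = integral_substitution[OF int der cont nn le]
  show "set_integrable lborel J (\<lambda>t. F (c + arcsin_turn t) * arcsin_turn' t)"
    using sub(1) by (simp add: J_def)
  show "(LBINT u:{a..b}. F u) = (LBINT t:J. F (c + arcsin_turn t) * arcsin_turn' t)"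
    using sub(2) unfolding g by (simp add: J_def set_lebesgue_integral_def mult.commute)
qed

text \<open>Critical points of \<open>sin (2 * pi * u)\<close> lie at 1/4 + k/2, so branches are
  centred at half-integers c, where the sine vanishes and the cosine is the sign s.\<close>

lemma branch_sin:
  assumes "2 * c \<in> \<int>"
  obtains s where "\<bar>s\<bar> = 1" "\<And>u. sin (2 * pi * u) = s * sin (2 * pi * (u - c))"
proof -
  have "sin (2 * pi * c) = 0" using assms
    by (elim Ints_cases) (metis (no_types, opaque_lifting) mult.assoc mult.commute sin_zero_iff_int2)
  then have s: "\<bar>cos (2 * pi * c)\<bar> = 1" "sin (2 * pi * c) = 0" by (auto simp: sin_zero_abs_cos_one)
  have "sin (2 * pi * u) = cos (2 * pi * c) * sin (2 * pi * (u - c))" for u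
  proof -
    have "2 * pi * (u - c) + 2 * pi * c = 2 * pi * u" by (simp add: algebra_simps)
    then show ?thesis using sin_add[of "2 * pi * (u - c)" "2 * pi * c"] by (simp add: s(2))
  qed
  with s(1) show ?thesis by (rule that)
qed

lemma sin_arcsin_turn: "\<bar>t\<bar> < 1 \<Longrightarrow> sin (2 * pi * arcsin_turn t) = t"
  by (simp add: arcsin_turn_def abs_less_iff)

text \<open>An interval of length at most 1/2 meets at most two monotone branches of \<open>sin (2 * pi * u)\<close>,
  and on each at most \<open>2 * \<kappa>\<close> of its length lies within \<open>\<kappa>\<close> of a critical point.\<close>

lemma set_integral_branch_decomposition:
  fixes g :: "real \<Rightarrow> real"
  assumes m: "g \<in> borel_measurable borel" and B: "\<And>u. \<bar>g u\<bar> \<le> B"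
    and \<kappa>: "0 < \<kappa>" "\<kappa> \<le> 1 / 6"
    and core: "\<And>c a b. 2 * c \<in> \<int> \<Longrightarrow> c - 1 / 4 + \<kappa> \<le> a \<Longrightarrow> a \<le> b \<Longrightarrow> b \<le> c + 1 / 4 - \<kappa> \<Longrightarrow>
      \<bar>LBINT u:{a..b}. g u\<bar> \<le> e"
    and ab: "a \<le> b" "b \<le> a + 1 / 2"
  shows "\<bar>LBINT u:{a..b}. g u\<bar> \<le> 2 * e + 4 * B * \<kappa>"
proof -
  have B0: "0 \<le> B" using B[of 0] by (meson abs_ge_zero order_trans)
  \<comment> \<open>A one-point interval in the core hypothesis forces e to be nonnegative.\<close>
  have "\<bar>LBINT u:{0..0}. g u\<bar> \<le> e" by (rule core[of 0]) (use \<kappa> in auto)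
  then have e0: "0 \<le> e" by linarith
  have part: "\<bar>LBINT u:{a..b}. g u\<bar> \<le> B * (b - a)" if "a \<le> b" for a b
    using set_integral_Icc_bound[OF m B that] .
  have half: "\<bar>LBINT u:{a..b}. g u\<bar> \<le> e + 2 * B * \<kappa>"
    if c: "2 * c \<in> \<int>" and ab: "c - 1 / 4 \<le> a" "a \<le> b" "b \<le> c + 1 / 4" for a b c
  proof (cases "b \<le> c - 1 / 4 + \<kappa> \<or> c + 1 / 4 - \<kappa> \<le> a")
    case True
    then have "B * (b - a) \<le> B * \<kappa>" using ab B0 by (intro mult_left_mono) auto
    then show ?thesis using part[OF ab(2)] e0 B0 \<kappa> mult_nonneg_nonneg[OF B0, of \<kappa>] by simp
  next
    case False
    define a' where "a' = max a (c - 1 / 4 + \<kappa>)"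
    define b' where "b' = min b (c + 1 / 4 - \<kappa>)"
    have le: "a \<le> a'" "a' \<le> b'" "b' \<le> b" "a' - a \<le> \<kappa>" "b - b' \<le> \<kappa>"
      "c - 1 / 4 + \<kappa> \<le> a'" "b' \<le> c + 1 / 4 - \<kappa>"
      using False ab \<kappa> by (auto simp: a'_def b'_def)
    have "(LBINT u:{a..b}. g u) = (LBINT u:{a..a'}. g u) + (LBINT u:{a'..b'}. g u) + (LBINT u:{b'..b}. g u)"
      using set_integral_Icc_combine[OF m B, of a a' b] set_integral_Icc_combine[OF m B, of a' b' b] le by simp
    moreover have "\<bar>LBINT u:{a..a'}. g u\<bar> \<le> B * \<kappa>"
      using part[OF le(1)] mult_left_mono[OF le(4) B0] by linarith
    moreover have "\<bar>LBINT u:{b'..b}. g u\<bar> \<le> B * \<kappa>"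
      using part[OF le(3)] mult_left_mono[OF le(5) B0] by linarith
    moreover have "\<bar>LBINT u:{a'..b'}. g u\<bar> \<le> e" by (rule core[OF c le(6,2,7)])
    ultimately show ?thesis by linarith
  qed
  \<comment> \<open>A half-integer nearest to a, hence the centre of a branch containing a. As b
    \<le> a + 1/2 \<le> c + 3/4, the branch centred at c + 1/2 covers the rest.\<close>
  define c where "c = of_int \<lfloor>2 * a + 1 / 2\<rfloor> / (2::real)"
  have c: "2 * c \<in> \<int>" "2 * (c + 1 / 2) \<in> \<int>" by (auto simp: c_def algebra_simps)
  have ac: "c - 1 / 4 \<le> a" "a \<le> c + 1 / 4" unfolding c_def by linarith+
  show ?thesis
  proof (cases "b \<le> c + 1 / 4")
    case True
    then show ?thesis using half[OF c(1) ac(1) ab(1)] e0 mult_nonneg_nonneg[OF B0, of \<kappa>] \<kappa> by simp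
  next
    case False
    then have "(LBINT u:{a..b}. g u) = (LBINT u:{a..c + 1 / 4}. g u) + (LBINT u:{c + 1 / 4..b}. g u)"
      using ac by (intro set_integral_Icc_combine[OF m B]) auto
    then show ?thesis
      using half[OF c(1) ac(1,2)] half[OF c(2), of "c + 1 / 4" b] False ab ac by simp
  qed
qed

section \<open>Shifting the value of the sine\<close>

text \<open>In the variable t = sin (2 pi u) the shift is a translation, which preserves Lebesgue
  measure. What it changes is the slow argument (cost K/\<kappa> times the density bound
  1/\<kappa>), the density (cost B/\<kappa>^3), and the membership in J near its two endpoints (cost
  B/\<kappa> on length 4|\<epsilon>|).\<close>

lemma sin_shift_branch:
  fixes H :: "real \<Rightarrow> real \<Rightarrow> real"
  assumes H: "case_prod H \<in> borel_measurable (borel \<Otimes>\<^sub>M borel)"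
    and B: "\<And>u t. \<bar>H u t\<bar> \<le> B" and K: "\<And>u u' t. \<bar>H u t - H u' t\<bar> \<le> K * \<bar>u - u'\<bar>"
    and \<kappa>: "0 < \<kappa>" "\<kappa> \<le> 1 / 6" and c: "2 * c \<in> \<int>"
    and ab: "c - 1 / 4 + \<kappa> \<le> a" "a \<le> b" "b \<le> c + 1 / 4 - \<kappa>"
  shows "\<bar>LBINT u:{a..b}. H u (sin (2 * pi * u) + \<epsilon>) - H u (sin (2 * pi * u))\<bar> \<le> 6 * (B + K) * \<bar>\<epsilon>\<bar> / \<kappa> ^ 3"
proof -
  obtain s where s: "\<bar>s\<bar> = 1" "\<And>u. sin (2 * pi * u) = s * sin (2 * pi * (u - c))"
    using branch_sin[OF c] by blast
  have B0: "0 \<le> B" using B[of 0 0] by (meson abs_ge_zero order_trans)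
  have K0: "0 \<le> K" using K[of 1 0 0] by (simp add: order_trans[OF abs_ge_zero])
  define J where "J = {sin (2 * pi * (a - c)) .. sin (2 * pi * (b - c))}"
  define \<alpha> where "\<alpha> = sin (2 * pi * (a - c))"
  define \<beta> where "\<beta> = sin (2 * pi * (b - c))"
  have J: "J = {\<alpha>..\<beta>}" by (simp add: J_def \<alpha>_def \<beta>_def)
  note mH [measurable] = borel_measurable_case_prod_compose[OF H]
  have [measurable]: "(\<lambda>u. H u (sin (2 * pi * u) + \<delta>)) \<in> borel_measurable borel" for \<delta>
    by (intro mH) measurable
  note sub = branch_substitution[OF _ _ \<kappa> ab, folded J_def]
  have core: "\<kappa>\<^sup>2 \<le> 1 - t\<^sup>2" if "t \<in> J" for t
    using sub(3)[of "\<lambda>_. 0" 0] that by simp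
  have \<alpha>\<beta>: "\<alpha> \<le> \<beta>" using sub(4)[of "\<lambda>_. 0" 0] by (simp add: \<alpha>_def \<beta>_def)
  \<comment> \<open>On a decreasing branch a positive shift of the sine moves t backwards: s (t +
    \<epsilon>') = s t + \<epsilon>.\<close>
  define \<epsilon>' where "\<epsilon>' = s * \<epsilon>"
  have \<epsilon>': "\<bar>\<epsilon>'\<bar> = \<bar>\<epsilon>\<bar>" "s * \<epsilon>' = \<epsilon>" using s(1) by (auto simp: \<epsilon>'_def abs_mult abs_if split: if_splits)
  define h where "h \<delta> t = indicator J t * (H (c + arcsin_turn t) (s * (t + \<delta>)) * arcsin_turn' t)" for \<delta> t
  have sinc: "sin (2 * pi * (c + arcsin_turn t)) = s * t" if "t \<in> J" for t
    using s(2)[of "c + arcsin_turn t"] sin_arcsin_turn[OF abs_less_1_core[OF \<kappa>(1) core[OF that]]] by simp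
  have hint: "integrable lborel (h \<delta>)" and hval: "(LBINT u:{a..b}. H u (sin (2 * pi * u) + s * \<delta>)) = integral\<^sup>L lborel (h \<delta>)" for \<delta>
  proof -
    have eq: "indicator J t *\<^sub>R (H (c + arcsin_turn t) (sin (2 * pi * (c + arcsin_turn t)) + s * \<delta>) * arcsin_turn' t) = h \<delta> t" for t
      by (cases "t \<in> J") (simp_all only: h_def sinc, simp_all add: distrib_left)
    show "integrable lborel (h \<delta>)"
      using sub(2)[of "\<lambda>u. H u (sin (2 * pi * u) + s * \<delta>)" B, unfolded set_integrable_def eq] B by simp
    show "(LBINT u:{a..b}. H u (sin (2 * pi * u) + s * \<delta>)) = integral\<^sup>L lborel (h \<delta>)"
      using sub(1)[of "\<lambda>u. H u (sin (2 * pi * u) + s * \<delta>)" B, unfolded set_lebesgue_integral_def[of _ J] eq] B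
      by simp
  qed
  \<comment> \<open>H is merely measurable in its second argument, so the shifted integrand is
    translated until both integrands evaluate H at the same second argument s t.\<close>
  define k where "k t = h \<epsilon>' (- \<epsilon>' + 1 * t)" for t
  have kint: "integrable lborel k"
    unfolding k_def using hint by (subst lborel_integrable_real_affine_iff) auto
  have hk: "integral\<^sup>L lborel (h \<epsilon>') = integral\<^sup>L lborel k"
    using lborel_integral_real_affine[of 1 "h \<epsilon>'" "- \<epsilon>'"] by (simp add: k_def[abs_def])
  let ?E = "\<lambda>x. {x - \<bar>\<epsilon>\<bar> .. x + \<bar>\<epsilon>\<bar>}"
  let ?C = "(K / \<kappa>\<^sup>2 + B / \<kappa> ^ 3) * \<bar>\<epsilon>\<bar>"
  let ?W = "\<lambda>t. B / \<kappa> * (indicator (?E \<alpha>) t + indicator (?E \<beta>) t) + ?C * indicator J t"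
  have C0: "0 \<le> ?C" "0 \<le> B / \<kappa>" using B0 K0 \<kappa> by auto
  have bnd: "\<bar>H u t * arcsin_turn' t'\<bar> \<le> B / \<kappa>" if "t' \<in> J" for u t t'
    using arcsin_turn'_bounds[OF \<kappa>(1) core[OF that]] B[of u t] B0
      mult_mono[OF B[of u t], of "\<bar>arcsin_turn' t'\<bar>" "1 / \<kappa>"]
    by (simp add: abs_mult)
  have pt: "\<bar>k t - h 0 t\<bar> \<le> ?W t" for t
  proof -
    have k: "k t = indicator J (t - \<epsilon>') * (H (c + arcsin_turn (t - \<epsilon>')) (s * t) * arcsin_turn' (t - \<epsilon>'))"
      by (simp add: k_def h_def)
    have edge: "B / \<kappa> \<le> ?W t" if "t \<in> ?E \<alpha> \<or> t \<in> ?E \<beta>"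
    proof -
      have "1 \<le> indicator (?E \<alpha>) t + (indicator (?E \<beta>) t :: real)" using that by (auto simp: indicator_def)
      from mult_left_mono[OF this C0(2)] show ?thesis
        using mult_nonneg_nonneg[OF C0(1), of "indicator J t"] by simp
    qed
    consider "t \<in> J" "t - \<epsilon>' \<in> J" | "t \<in> J" "t - \<epsilon>' \<notin> J" | "t \<notin> J" "t - \<epsilon>' \<in> J" | "t \<notin> J" "t - \<epsilon>' \<notin> J" by blast
    then show ?thesis
    proof cases
      case 1
      let ?p = "c + arcsin_turn (t - \<epsilon>')" and ?pp = "c + arcsin_turn t"
      let ?q = "arcsin_turn' (t - \<epsilon>')" and ?qq = "arcsin_turn' t"
      note lip = arcsin_turn_lipschitz[OF \<kappa>(1) core[OF 1(2)] core[OF 1(1)]]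
      have "\<bar>H ?p (s * t) - H ?pp (s * t)\<bar> \<le> K * (1 / \<kappa> * \<bar>\<epsilon>\<bar>)"
        using K[of ?p "s * t" ?pp] mult_left_mono[OF lip(1) K0] \<epsilon>'
        by (simp del: times_divide_eq_left times_divide_eq_right)
      then have 1: "\<bar>(H ?p (s * t) - H ?pp (s * t)) * ?q\<bar> \<le> (K * (1 / \<kappa> * \<bar>\<epsilon>\<bar>)) * (1 / \<kappa>)"
        unfolding abs_mult using arcsin_turn'_bounds[OF \<kappa>(1) core[OF 1(2)]] K0 \<kappa>
        by (intro mult_mono) auto
      have 2: "\<bar>H ?pp (s * t) * (?q - ?qq)\<bar> \<le> B * (1 / \<kappa> ^ 3 * \<bar>\<epsilon>\<bar>)"
        unfolding abs_mult using B lip(2) B0 \<epsilon>' by (intro mult_mono) auto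
      have "k t - h 0 t = (H ?p (s * t) - H ?pp (s * t)) * ?q + H ?pp (s * t) * (?q - ?qq)"
        using \<open>t \<in> J\<close> \<open>t - \<epsilon>' \<in> J\<close> by (simp add: k h_def algebra_simps)
      then have "\<bar>k t - h 0 t\<bar> \<le> (K * (1 / \<kappa> * \<bar>\<epsilon>\<bar>)) * (1 / \<kappa>) + B * (1 / \<kappa> ^ 3 * \<bar>\<epsilon>\<bar>)"
        using 1 2 by linarith
      also have "\<dots> = ?C" by (simp add: field_simps power2_eq_square)
      also have "\<dots> \<le> ?W t"
        using \<open>t \<in> J\<close> mult_nonneg_nonneg[OF C0(2), of "indicator (?E \<alpha>) t + indicator (?E \<beta>) t"]
        by simp
      finally show ?thesis .
    next
      case 2
      then have "t \<in> ?E \<alpha> \<or> t \<in> ?E \<beta>" using \<epsilon>'(1) by (auto simp: J)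
      then have "B / \<kappa> \<le> ?W t" by (rule edge)
      moreover have "\<bar>k t - h 0 t\<bar> \<le> B / \<kappa>" using 2 bnd[OF 2(1)] by (simp add: k h_def)
      ultimately show ?thesis by linarith
    next
      case 3
      then have "t \<in> ?E \<alpha> \<or> t \<in> ?E \<beta>" using \<epsilon>'(1) by (auto simp: J)
      then have "B / \<kappa> \<le> ?W t" by (rule edge)
      moreover have "\<bar>k t - h 0 t\<bar> \<le> B / \<kappa>" using 3 bnd[OF 3(2)] by (simp add: k h_def)
      ultimately show ?thesis by linarith
    next
      case 4
      then show ?thesis
        using mult_nonneg_nonneg[OF C0(2), of "indicator (?E \<alpha>) t + indicator (?E \<beta>) t"]
        by (simp add: k h_def)
    qed
  qed
  have "(LBINT u:{a..b}. H u (sin (2 * pi * u) + \<epsilon>) - H u (sin (2 * pi * u)))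
      = (LBINT u:{a..b}. H u (sin (2 * pi * u) + \<epsilon>)) - (LBINT u:{a..b}. H u (sin (2 * pi * u)))"
    using set_integrable_Icc_bounded[of "\<lambda>u. H u (sin (2 * pi * u) + \<epsilon>)" a b B]
      set_integrable_Icc_bounded[of "\<lambda>u. H u (sin (2 * pi * u) + 0)" a b B] B
    by (intro set_integral_diff) auto
  also have "\<dots> = integral\<^sup>L lborel k - integral\<^sup>L lborel (h 0)"
    using hval[of \<epsilon>'] hval[of 0] by (simp add: \<epsilon>' hk)
  also have "\<dots> = (\<integral>t. k t - h 0 t \<partial>lborel)" using kint hint by simp
  finally have "\<bar>LBINT u:{a..b}. H u (sin (2 * pi * u) + \<epsilon>) - H u (sin (2 * pi * u))\<bar> \<le> (\<integral>t. \<bar>k t - h 0 t\<bar> \<partial>lborel)"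
    using integral_abs_bound by metis
  also have "\<dots> \<le> integral\<^sup>L lborel ?W"
    using kint hint \<alpha>\<beta> by (intro integral_mono pt) (auto simp: J)
  also have "\<dots> = B / \<kappa> * (4 * \<bar>\<epsilon>\<bar>) + ?C * (\<beta> - \<alpha>)"
    using \<alpha>\<beta> by (simp add: J algebra_simps)
  \<comment> \<open>Everything is put over the worst power of \<kappa>, and J has length at most 2;
    then 4B + 2(K + B) \<le> 6(B + K).\<close>
  also have "\<dots> \<le> B / \<kappa> ^ 3 * (4 * \<bar>\<epsilon>\<bar>) + ((K / \<kappa> ^ 3 + B / \<kappa> ^ 3) * \<bar>\<epsilon>\<bar>) * 2"
  proof -
    have k1: "\<kappa> ^ 3 \<le> \<kappa>" "\<kappa> ^ 3 \<le> \<kappa>\<^sup>2"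
      using \<kappa> power_decreasing[of 1 3 \<kappa>] power_decreasing[of 2 3 \<kappa>] by auto
    have "B / \<kappa> \<le> B / \<kappa> ^ 3" "K / \<kappa>\<^sup>2 \<le> K / \<kappa> ^ 3"
      using k1 B0 K0 \<kappa> by (auto intro!: divide_left_mono)
    moreover have "\<beta> - \<alpha> \<le> 2"
      using sin_le_one[of "2 * pi * (b - c)"] sin_ge_minus_one[of "2 * pi * (a - c)"] unfolding \<alpha>_def \<beta>_def by linarith
    ultimately show ?thesis using B0 K0 \<kappa> \<alpha>\<beta> by (intro add_mono mult_mono) auto
  qed
  also have "\<dots> \<le> 6 * (B + K) * \<bar>\<epsilon>\<bar> / \<kappa> ^ 3"
    using B0 K0 \<kappa> by (simp add: field_simps)
  finally show ?thesis .
qed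

text \<open>The branch decomposition doubles the core estimate; the integrand is a difference
  bounded by \<open>2 * B\<close>, so the discarded pieces cost
  \<open>8 * B * \<kappa>\<close>.\<close>

lemma sin_shift:
  fixes H :: "real \<Rightarrow> real \<Rightarrow> real"
  assumes H: "case_prod H \<in> borel_measurable (borel \<Otimes>\<^sub>M borel)"
    and B: "\<And>u t. \<bar>H u t\<bar> \<le> B" and K: "\<And>u u' t. \<bar>H u t - H u' t\<bar> \<le> K * \<bar>u - u'\<bar>"
    and \<kappa>: "0 < \<kappa>" "\<kappa> \<le> 1 / 6" and ab: "a \<le> b" "b \<le> a + 1 / 2"
  shows "\<bar>LBINT u:{a..b}. H u (sin (2 * pi * u) + \<epsilon>) - H u (sin (2 * pi * u))\<bar>
    \<le> 12 * (B + K) * \<bar>\<epsilon>\<bar> / \<kappa> ^ 3 + 8 * B * \<kappa>"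
proof -
  have "(\<lambda>u. H u (sin (2 * pi * u) + \<epsilon>) - H u (sin (2 * pi * u))) \<in> borel_measurable borel"
    by (intro borel_measurable_diff borel_measurable_case_prod_compose[OF H]) measurable
  moreover have "\<bar>H u (sin (2 * pi * u) + \<epsilon>) - H u (sin (2 * pi * u))\<bar> \<le> 2 * B" for u
    using B[of u "sin (2 * pi * u) + \<epsilon>"] B[of u "sin (2 * pi * u)"] by linarith
  ultimately have "\<bar>LBINT u:{a..b}. H u (sin (2 * pi * u) + \<epsilon>) - H u (sin (2 * pi * u))\<bar>
      \<le> 2 * (6 * (B + K) * \<bar>\<epsilon>\<bar> / \<kappa> ^ 3) + 4 * (2 * B) * \<kappa>"
    by (rule set_integral_branch_decomposition[OF _ _ \<kappa> _ ab]) (rule sin_shift_branch[OF H B K \<kappa>])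
  also have "\<dots> = 12 * (B + K) * \<bar>\<epsilon>\<bar> / \<kappa> ^ 3 + 8 * B * \<kappa>" by simp
  finally show ?thesis .
qed

text \<open>On the core of a branch the density of t is at most \<open>1 / \<kappa>\<close>, and the
  admissible t fill an interval of length \<open>2 * \<rho>\<close>.\<close>

lemma sin_sublevel:
  assumes \<kappa>: "0 < \<kappa>" "\<kappa> \<le> 1 / 6" and "0 \<le> \<rho>" and ab: "a \<le> b" "b \<le> a + 1 / 2"
  shows "(LBINT u:{a..b}. indicator {y. \<bar>y + r\<bar> \<le> \<rho>} (sin (2 * pi * u))) \<le> 4 * \<rho> / \<kappa> + 4 * \<kappa>"
proof -
  let ?F = "\<lambda>u. indicator {y. \<bar>y + r\<bar> \<le> \<rho>} (sin (2 * pi * u)) :: real"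
  have m: "?F \<in> borel_measurable borel" by measurable
  have b: "\<bar>?F u\<bar> \<le> 1" for u by (simp add: indicator_def)
  have "\<bar>LBINT u:{a..b}. ?F u\<bar> \<le> 2 * \<rho> / \<kappa>"
    if c: "2 * c \<in> \<int>" and ab: "c - 1 / 4 + \<kappa> \<le> a" "a \<le> b" "b \<le> c + 1 / 4 - \<kappa>" for a b c
  proof -
    obtain s where s: "\<bar>s\<bar> = 1" "\<And>u. sin (2 * pi * u) = s * sin (2 * pi * (u - c))"
      using branch_sin[OF c] by blast
    define J where "J = {sin (2 * pi * (a - c)) .. sin (2 * pi * (b - c))}"
    note sub = branch_substitution[OF m b \<kappa> ab, folded J_def]
    have le: "indicator J t *\<^sub>R (?F (c + arcsin_turn t) * arcsin_turn' t)
        \<le> 1 / \<kappa> * indicator {- s * r - \<rho> .. - s * r + \<rho>} t"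
      and nn: "0 \<le> indicator J t *\<^sub>R (?F (c + arcsin_turn t) * arcsin_turn' t)" for t
    proof (atomize (full), cases "t \<in> J")
      case True
      note q = arcsin_turn'_bounds[OF \<kappa>(1) sub(3)[OF True]]
      have "sin (2 * pi * (c + arcsin_turn t)) = s * t"
        using s(2)[of "c + arcsin_turn t"] sin_arcsin_turn[OF abs_less_1_core[OF \<kappa>(1) sub(3)[OF True]]] by simp
      moreover have "t \<in> {- s * r - \<rho> .. - s * r + \<rho>}" if "\<bar>s * t + r\<bar> \<le> \<rho>"
        using that s(1) by (auto simp: abs_if split: if_splits)
      ultimately show "indicator J t *\<^sub>R (?F (c + arcsin_turn t) * arcsin_turn' t)
        \<le> 1 / \<kappa> * indicator {- s * r - \<rho> .. - s * r + \<rho>} t \<and>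
        0 \<le> indicator J t *\<^sub>R (?F (c + arcsin_turn t) * arcsin_turn' t)"
        using q True \<kappa> by (auto simp: indicator_def)
    qed (use \<kappa> in auto)
    have "(LBINT u:{a..b}. ?F u) \<le> (\<integral>t. 1 / \<kappa> * indicator {- s * r - \<rho> .. - s * r + \<rho>} t \<partial>lborel)"
      unfolding sub(1) set_lebesgue_integral_def[of _ J]
      using sub(2)[unfolded set_integrable_def] \<open>0 \<le> \<rho>\<close> by (intro integral_mono le) simp_all
    also have "\<dots> = 2 * \<rho> / \<kappa>" using \<open>0 \<le> \<rho>\<close> by simp
    finally have "(LBINT u:{a..b}. ?F u) \<le> 2 * \<rho> / \<kappa>" .
    moreover have "0 \<le> (LBINT u:{a..b}. ?F u)"
      unfolding set_lebesgue_integral_def by (rule integral_nonneg_AE) simp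
    ultimately show ?thesis by simp
  qed
  then have "\<bar>LBINT u:{a..b}. ?F u\<bar> \<le> 2 * (2 * \<rho> / \<kappa>) + 4 * 1 * \<kappa>"
    by (rule set_integral_branch_decomposition[OF m b \<kappa> _ ab])
  then show ?thesis by simp
qed

section \<open>Averages over the noise\<close>

lemma integral_uniform_measure_Icc:
  fixes g :: "real \<Rightarrow> real"
  assumes "a < b" and [measurable]: "g \<in> borel_measurable borel"
  shows "(\<integral>u. g u \<partial>uniform_measure lborel {a..b}) = (LBINT u:{a..b}. g u) / (b - a)"
proof -
  have "uniform_measure lborel {a..b} = density lborel (\<lambda>u. ennreal (indicator {a..b} u / (b - a)))"
    unfolding uniform_measure_def using assms(1)
    by (intro density_cong) (auto simp: indicator_def divide_ennreal simp flip: ennreal_1)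
  then have "(\<integral>u. g u \<partial>uniform_measure lborel {a..b}) = (\<integral>u. (indicator {a..b} u / (b - a)) *\<^sub>R g u \<partial>lborel)"
    using assms(1) by (simp add: integral_density)
  also have "\<dots> = (LBINT u:{a..b}. g u) / (b - a)"
    by (simp add: set_lebesgue_integral_def flip: integral_divide_zero)
  finally show ?thesis .
qed

lemma prob_space_uniform_Icc: "a < b \<Longrightarrow> prob_space (uniform_measure lborel {a..b::real})"
  by (intro prob_space_uniform_measure) auto

text \<open>Normalising to uniform probability measures makes every bounded measurable function
  integrable, so Fubini applies; the lengths cancel afterwards.\<close>

lemma set_integral_Icc_swap:
  fixes G :: "real \<Rightarrow> real \<Rightarrow> real"
  assumes G: "case_prod G \<in> borel_measurable (borel \<Otimes>\<^sub>M borel)" and B: "\<And>x y. \<bar>G x y\<bar> \<le> B"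
    and ab: "a < b" "c < d"
  shows "(LBINT x:{a..b}. LBINT y:{c..d}. G x y) = (LBINT y:{c..d}. LBINT x:{a..b}. G x y)"
proof -
  let ?U = "uniform_measure lborel {a..b}" and ?V = "uniform_measure lborel {c..d}"
  interpret U: prob_space ?U by (rule prob_space_uniform_Icc) fact
  interpret V: prob_space ?V by (rule prob_space_uniform_Icc) fact
  interpret UV: pair_prob_space ?U ?V ..
  note [measurable] = borel_measurable_case_prod_compose[OF G] G
  have sets: "sets ?U = sets borel" "sets ?V = sets borel" by auto
  have "integrable (?U \<Otimes>\<^sub>M ?V) (case_prod G)"
    using B G measurable_cong_sets[OF sets_pair_measure_cong[OF sets] refl, of borel]
    by (intro UV.P.integrable_const_bound[where B=B]) auto
  from UV.Fubini_integral[OF this]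
  have *: "(\<integral>y. (\<integral>x. G x y \<partial>?U) \<partial>?V) = (\<integral>x. (\<integral>y. G x y \<partial>?V) \<partial>?U)" .
  have 1: "(\<integral>x. G x y \<partial>?U) = (LBINT x:{a..b}. G x y) / (b - a)" for y
    using ab by (intro integral_uniform_measure_Icc) auto
  have 2: "(\<integral>y. G x y \<partial>?V) = (LBINT y:{c..d}. G x y) / (d - c)" for x
    using ab by (intro integral_uniform_measure_Icc) auto
  have m1: "(\<lambda>y. LBINT x:{a..b}. G x y) \<in> borel_measurable borel"
    unfolding set_lebesgue_integral_def by measurable
  have m2: "(\<lambda>x. LBINT y:{c..d}. G x y) \<in> borel_measurable borel"
    unfolding set_lebesgue_integral_def by measurable
  have "(LBINT y:{c..d}. (LBINT x:{a..b}. G x y) / (b - a)) / (d - c)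
      = (LBINT x:{a..b}. (LBINT y:{c..d}. G x y) / (d - c)) / (b - a)"
    using * m1 m2 ab unfolding 1 2
    by (subst (asm) (1 2) integral_uniform_measure_Icc) auto
  then have "(LBINT y:{c..d}. LBINT x:{a..b}. G x y) / ((b - a) * (d - c))
      = (LBINT x:{a..b}. LBINT y:{c..d}. G x y) / ((b - a) * (d - c))"
    by (simp add: mult.commute)
  moreover have "(b - a) * (d - c) \<noteq> 0" using ab by simp
  ultimately show ?thesis by (simp only: divide_cancel_right) simp
qed

lemma set_integral_Icc_shift:
  fixes h :: "real \<Rightarrow> real"
  shows "(LBINT c:{a + t..b + t}. h c) = (LBINT c:{a..b}. h (c + t))"
proof -
  have "(LBINT c:{a + t..b + t}. h c) = (\<integral>c. indicator {a + t..b + t} (t + 1 * c) *\<^sub>R h (t + 1 * c) \<partial>lborel)"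
    unfolding set_lebesgue_integral_def by (subst lborel_integral_real_affine[of 1 _ t]) auto
  also have "\<dots> = (LBINT c:{a..b}. h (c + t))"
    unfolding set_lebesgue_integral_def
    by (intro Bochner_Integration.integral_cong) (auto simp: indicator_def add.commute)
  finally show ?thesis .
qed

lemma set_integral_periodic:
  fixes h :: "real \<Rightarrow> real"
  assumes m: "h \<in> borel_measurable borel" and B: "\<And>c. \<bar>h c\<bar> \<le> B"
    and per: "\<And>c n. h (c + of_int n) = h c"
  shows "(LBINT c:{0..1}. h (c + t)) = (LBINT c:{0..1}. h c)"
proof -
  define n where "n = \<lfloor>t\<rfloor>"
  have n: "of_int n \<le> t" "t \<le> of_int n + 1" unfolding n_def by linarith+
  have "(LBINT c:{0..1}. h (c + t)) = (LBINT c:{t..1 + t}. h c)"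
    using set_integral_Icc_shift[of 0 t 1 h] by simp
  also have "\<dots> = (LBINT c:{t..of_int n + 1}. h c) + (LBINT c:{of_int n + 1..t + 1}. h c)"
    using n set_integral_Icc_combine[OF m B, of t "of_int n + 1" "1 + t"] by (simp add: add.commute)
  also have "(LBINT c:{of_int n + 1..t + 1}. h c) = (LBINT c:{of_int n..t}. h c)"
    using set_integral_Icc_shift[of "of_int n" 1 t h] per[of _ 1] by simp
  also have "(LBINT c:{t..of_int n + 1}. h c) + (LBINT c:{of_int n..t}. h c) = (LBINT c:{of_int n..of_int n + 1}. h c)"
    using n set_integral_Icc_combine[OF m B, of "of_int n" t "of_int n + 1"] by simp
  also have "\<dots> = (LBINT c:{0..1}. h c)"
    using set_integral_Icc_shift[of 0 "of_int n" 1 h] per[of _ n] by (simp add: add.commute)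
  finally show ?thesis .
qed

section \<open>Averages over a moving window\<close>

definition box_avg :: "real \<Rightarrow> real \<Rightarrow> (real \<Rightarrow> real) \<Rightarrow> real" where
  "box_avg s x g = (LBINT u:{x - s..x + s}. g u) / (2 * s)"

lemma box_avg_uniform:
  assumes "0 < s" and [measurable]: "g \<in> borel_measurable borel"
  shows "(\<integral>w. g (x + w) \<partial>uniform_measure lborel {- s..s}) = box_avg s x g"
proof -
  have "(\<integral>w. g (x + w) \<partial>uniform_measure lborel {- s..s}) = (LBINT w:{- s..s}. g (w + x)) / (s - - s)"
    using assms(1) by (subst integral_uniform_measure_Icc) (auto simp: add.commute)
  also have "\<dots> = box_avg s x g"
    using set_integral_Icc_shift[of "- s" x s g] by (simp add: box_avg_def add.commute)
  finally show ?thesis .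
qed

lemma box_avg_abs_le:
  assumes "0 < s" "g \<in> borel_measurable borel" "\<And>u. \<bar>g u\<bar> \<le> B"
  shows "\<bar>box_avg s x g\<bar> \<le> B"
  using set_integral_Icc_bound[OF assms(2,3), of "x - s" "x + s"] assms(1)
  by (simp add: box_avg_def field_simps)

lemma box_avg_diff:
  assumes "g \<in> borel_measurable borel" "\<And>u. \<bar>g u\<bar> \<le> B" "h \<in> borel_measurable borel" "\<And>u. \<bar>h u\<bar> \<le> C"
  shows "box_avg s x (\<lambda>u. g u - h u) = box_avg s x g - box_avg s x h"
  using set_integrable_Icc_bounded[OF assms(1), of "x - s" "x + s" B]
    set_integrable_Icc_bounded[OF assms(3), of "x - s" "x + s" C] assms(2,4)
  by (simp add: box_avg_def diff_divide_distrib)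

lemma box_avg_diff_le:
  assumes "0 < s" "g \<in> borel_measurable borel" "\<And>u. \<bar>g u\<bar> \<le> B" "h \<in> borel_measurable borel" "\<And>u. \<bar>h u\<bar> \<le> C"
    and "\<And>u. \<bar>g u - h u\<bar> \<le> e"
  shows "\<bar>box_avg s x g - box_avg s x h\<bar> \<le> e"
  unfolding box_avg_diff[OF assms(2-5), symmetric]
  using assms(1,2,4,6) by (intro box_avg_abs_le) auto

lemma box_avg_mono:
  assumes "0 < s" "g \<in> borel_measurable borel" "\<And>u. \<bar>g u\<bar> \<le> B" "h \<in> borel_measurable borel" "\<And>u. \<bar>h u\<bar> \<le> C"
    and "\<And>u. g u \<le> h u"
  shows "box_avg s x g \<le> box_avg s x h"
  unfolding box_avg_def
  using assms by (intro divide_right_mono set_integral_mono set_integrable_Icc_bounded) auto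

lemma box_avg_const: "0 < s \<Longrightarrow> box_avg s x (\<lambda>u. c) = c"
  by (simp add: box_avg_def set_integral_const)

text \<open>Moving the window exchanges only two end pieces of length |x - x'|, each contributing at
  most B |x - x'| before division by \<open>2 * s\<close>. All regularity of the process is obtained
  from this estimate.\<close>

lemma box_avg_lipschitz:
  assumes s: "0 < s" and m: "g \<in> borel_measurable borel" and B: "\<And>u. \<bar>g u\<bar> \<le> B"
  shows "\<bar>box_avg s x g - box_avg s x' g\<bar> \<le> B / s * \<bar>x - x'\<bar>"
proof -
  have B0: "0 \<le> B" using B[of 0] by (meson abs_ge_zero order_trans)
  have *: "\<bar>box_avg s x g - box_avg s x' g\<bar> \<le> B / s * \<bar>x - x'\<bar>" if le: "x \<le> x'" for x x'
  proof (cases "x' - s \<le> x + s")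
    case True
    have "(LBINT u:{x - s..x + s}. g u) = (LBINT u:{x - s..x' - s}. g u) + (LBINT u:{x' - s..x + s}. g u)"
      using True le by (intro set_integral_Icc_combine[OF m B]) auto
    moreover have "(LBINT u:{x' - s..x' + s}. g u) = (LBINT u:{x' - s..x + s}. g u) + (LBINT u:{x + s..x' + s}. g u)"
      using True le by (intro set_integral_Icc_combine[OF m B]) auto
    moreover have "\<bar>LBINT u:{x - s..x' - s}. g u\<bar> \<le> B * (x' - x)" "\<bar>LBINT u:{x + s..x' + s}. g u\<bar> \<le> B * (x' - x)"
      using set_integral_Icc_bound[OF m B, of "x - s" "x' - s"] set_integral_Icc_bound[OF m B, of "x + s" "x' + s"] le by auto
    ultimately have "\<bar>(LBINT u:{x - s..x + s}. g u) - (LBINT u:{x' - s..x' + s}. g u)\<bar> \<le> 2 * (B * (x' - x))"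
      by linarith
    then have "\<bar>(LBINT u:{x - s..x + s}. g u) - (LBINT u:{x' - s..x' + s}. g u)\<bar> / (2 * s) \<le> 2 * (B * (x' - x)) / (2 * s)"
      using s by (intro divide_right_mono) auto
    also have "2 * (B * (x' - x)) / (2 * s) = B * (x' - x) / s"
      by (rule mult_divide_mult_cancel_left) simp
    also have "\<dots> = B / s * \<bar>x - x'\<bar>" using le by simp
    finally have "\<bar>((LBINT u:{x - s..x + s}. g u) - (LBINT u:{x' - s..x' + s}. g u)) / (2 * s)\<bar> \<le> B / s * \<bar>x - x'\<bar>"
      using s by (simp only: abs_divide abs_mult abs_numeral abs_of_pos)
    then show ?thesis by (simp only: box_avg_def diff_divide_distrib)
  next
    \<comment> \<open>The windows are disjoint, so |x - x'| exceeds \<open>2 * s\<close> and the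
      trivial bound \<open>2 * B\<close> suffices.\<close>
    case False
    then have "1 \<le> (x' - x) / (2 * s)" using s by (simp add: field_simps)
    then have "2 * B * 1 \<le> 2 * B * ((x' - x) / (2 * s))" using B0 by (intro mult_left_mono) auto
    also have "\<dots> = B / s * \<bar>x - x'\<bar>" using le by simp
    finally show ?thesis using box_avg_abs_le[OF s m B, of x] box_avg_abs_le[OF s m B, of x'] by linarith
  qed
  show ?thesis using *[of x x'] *[of x' x] by (cases "x \<le> x'") (auto simp: abs_minus_commute)
qed

lemma continuous_on_box_avg:
  assumes "0 < s" "g \<in> borel_measurable borel" "\<And>u. \<bar>g u\<bar> \<le> B"
  shows "continuous_on UNIV (\<lambda>x. box_avg s x g)"
proof -
  have "0 \<le> B" using assms(3)[of 0] by (meson abs_ge_zero order_trans)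
  then have "(B / s)-lipschitz_on UNIV (\<lambda>x. box_avg s x g)"
    using box_avg_lipschitz[OF assms] assms(1) by (auto simp: lipschitz_on_def dist_real_def)
  then show ?thesis by (rule lipschitz_on_continuous_on)
qed

text \<open>The condition \<open>s \<le> 1 / 4\<close> keeps the window within length 1/2, so that
  it meets at most two branches.\<close>

lemma box_avg_sin_shift:
  assumes "0 < s" "s \<le> 1 / 4" and H: "case_prod H \<in> borel_measurable (borel \<Otimes>\<^sub>M borel)"
    and B: "\<And>u t. \<bar>H u t\<bar> \<le> B" and K: "\<And>u u' t. \<bar>H u t - H u' t\<bar> \<le> K * \<bar>u - u'\<bar>"
    and \<kappa>: "0 < \<kappa>" "\<kappa> \<le> 1 / 6"
  shows "\<bar>box_avg s x (\<lambda>u. H u (sin (2 * pi * u) + \<epsilon>)) - box_avg s x (\<lambda>u. H u (sin (2 * pi * u)))\<bar>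
    \<le> (6 * (B + K) * \<bar>\<epsilon>\<bar> / \<kappa> ^ 3 + 4 * B * \<kappa>) / s"
proof -
  have [measurable]: "(\<lambda>u. H u (sin (2 * pi * u) + \<epsilon>)) \<in> borel_measurable borel"
    "(\<lambda>u. H u (sin (2 * pi * u))) \<in> borel_measurable borel"
    by (auto intro!: borel_measurable_case_prod_compose[OF H])
  have "box_avg s x (\<lambda>u. H u (sin (2 * pi * u) + \<epsilon>)) - box_avg s x (\<lambda>u. H u (sin (2 * pi * u)))
      = (LBINT u:{x - s..x + s}. H u (sin (2 * pi * u) + \<epsilon>) - H u (sin (2 * pi * u))) / (2 * s)"
    using B by (subst box_avg_diff[symmetric]) (auto simp: box_avg_def)
  moreover have "\<bar>LBINT u:{x - s..x + s}. H u (sin (2 * pi * u) + \<epsilon>) - H u (sin (2 * pi * u))\<bar> / (2 * s)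
      \<le> (12 * (B + K) * \<bar>\<epsilon>\<bar> / \<kappa> ^ 3 + 8 * B * \<kappa>) / (2 * s)"
    using assms(1,2) by (intro divide_right_mono sin_shift[OF H B K \<kappa>]) auto
  moreover have "(12 * (B + K) * \<bar>\<epsilon>\<bar> / \<kappa> ^ 3 + 8 * B * \<kappa>) / (2 * s) = (6 * (B + K) * \<bar>\<epsilon>\<bar> / \<kappa> ^ 3 + 4 * B * \<kappa>) / s"
  proof -
    have *: "12 * (B + K) * \<bar>\<epsilon>\<bar> / \<kappa> ^ 3 + 8 * B * \<kappa> = 2 * (6 * (B + K) * \<bar>\<epsilon>\<bar> / \<kappa> ^ 3 + 4 * B * \<kappa>)"
      by (simp add: algebra_simps add_divide_distrib)
    show ?thesis unfolding * by (rule mult_divide_mult_cancel_left) simp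
  qed
  ultimately show ?thesis using assms(1) by (simp only: abs_divide abs_mult abs_numeral abs_of_pos)
qed

lemma measurable_std_f [measurable]: "std_f L \<in> borel_measurable borel"
  unfolding std_f_def[abs_def] by measurable

lemma measurable_dstd_f [measurable]: "dstd_f L \<in> borel_measurable borel"
  unfolding dstd_f_def[abs_def] by measurable

lemma cos_equidistribution:
  assumes s: "0 < s" "s \<le> 1 / 4" and R: "case_prod R \<in> borel_measurable (borel \<Otimes>\<^sub>M borel)"
    and B: "\<And>c u. \<bar>R c u\<bar> \<le> B" and K: "\<And>c u u'. \<bar>R c u - R c u'\<bar> \<le> K * \<bar>u - u'\<bar>"
    and per: "\<And>c n u. R (c + of_int n) u = R c u"
    and \<kappa>: "0 < \<kappa>" "\<kappa> \<le> 1 / 6" and L: "0 < L"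
  shows "\<bar>box_avg s x (\<lambda>u. R (std_f L u) u) - box_avg s x (\<lambda>u. LBINT c:{0..1}. R c u)\<bar>
    \<le> (6 * (B + K) / (L * \<kappa> ^ 3) + 4 * B * \<kappa>) / s"
proof -
  let ?e = "(6 * (B + K) / (L * \<kappa> ^ 3) + 4 * B * \<kappa>) / s"
  note mR = borel_measurable_case_prod_compose[OF R]
  have B0: "0 \<le> B" using B[of 0 0] by (meson abs_ge_zero order_trans)
  have K0: "0 \<le> K" using K[of 0 1 0] by (simp add: order_trans[OF abs_ge_zero])
  have mG: "case_prod (\<lambda>\<theta> u. R (std_f L u + \<theta>) u) \<in> borel_measurable (borel \<Otimes>\<^sub>M borel)"
    unfolding split_beta by (intro mR) measurable
  have mGu: "(\<lambda>u. R (std_f L u + \<theta>) u) \<in> borel_measurable borel" for \<theta> by (intro mR) measurable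
  \<comment> \<open>\<open>\<theta>\<close> translates the fast variable \<open>cos (2 * pi * u)\<close> by only \<open>\<theta> / L\<close>, while averaging over
    \<open>\<theta>\<close> produces the integral over a full period.\<close>
  have shift: "\<bar>box_avg s x (\<lambda>u. R (std_f L u + \<theta>) u) - box_avg s x (\<lambda>u. R (std_f L u) u)\<bar> \<le> ?e"
    if \<theta>: "\<theta> \<in> {0..1}" for \<theta>
  proof -
    \<comment> \<open>A quarter turn changes the cosine into a sine, as the shift estimate requires;
      the window moves along to x + 1/4.\<close>
    define H where "H u t = R (L * t) (u - 1 / 4)" for u t
    have mH: "case_prod H \<in> borel_measurable (borel \<Otimes>\<^sub>M borel)"
      unfolding split_beta H_def by (intro mR) measurable
    have sc: "std_f L (u - 1 / 4) = L * sin (2 * pi * u)" for u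
    proof -
      have "2 * pi * (u - 1 / 4) = - (pi / 2 - 2 * pi * u)" by (simp add: algebra_simps)
      then show ?thesis by (simp only: std_f_def cos_minus) (simp add: cos_sin_eq)
    qed
    have move: "box_avg s (x + 1 / 4) (\<lambda>u. g (u - 1 / 4)) = box_avg s x g" for g
      using set_integral_Icc_shift[of "x - s" "1 / 4" "x + s" "\<lambda>u. g (u - 1 / 4)"]
      by (simp add: box_avg_def algebra_simps)
    have "R (std_f L (u - 1 / 4) + \<theta>) (u - 1 / 4) = H u (sin (2 * pi * u) + \<theta> / L)"
      "R (std_f L (u - 1 / 4)) (u - 1 / 4) = H u (sin (2 * pi * u))" for u
      using L by (simp_all add: H_def sc distrib_left)
    then have "box_avg s x (\<lambda>u. R (std_f L u + \<theta>) u) = box_avg s (x + 1 / 4) (\<lambda>u. H u (sin (2 * pi * u) + \<theta> / L))"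
      "box_avg s x (\<lambda>u. R (std_f L u) u) = box_avg s (x + 1 / 4) (\<lambda>u. H u (sin (2 * pi * u)))"
      using move[of "\<lambda>u. R (std_f L u + \<theta>) u"] move[of "\<lambda>u. R (std_f L u) u"] by simp_all
    moreover have "\<bar>box_avg s (x + 1 / 4) (\<lambda>u. H u (sin (2 * pi * u) + \<theta> / L)) - box_avg s (x + 1 / 4) (\<lambda>u. H u (sin (2 * pi * u)))\<bar>
        \<le> (6 * (B + K) * \<bar>\<theta> / L\<bar> / \<kappa> ^ 3 + 4 * B * \<kappa>) / s"
      by (rule box_avg_sin_shift[OF s mH _ _ \<kappa>]) (use B K[of _ "_ - 1 / 4" "_ - 1 / 4"] in \<open>simp_all add: H_def\<close>)
    moreover have "(6 * (B + K) * \<bar>\<theta> / L\<bar> / \<kappa> ^ 3 + 4 * B * \<kappa>) / s \<le> ?e"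
    proof -
      have "6 * (B + K) * \<bar>\<theta> / L\<bar> / \<kappa> ^ 3 \<le> 6 * (B + K) * (1 / L) / \<kappa> ^ 3"
        using \<theta> L \<kappa> B0 K0 divide_right_mono[of \<theta> 1 L] by (intro divide_right_mono mult_left_mono) auto
      then show ?thesis using s by (intro divide_right_mono) auto
    qed
    ultimately show ?thesis by linarith
  qed
  have mA: "(\<lambda>\<theta>. box_avg s x (\<lambda>u. R (std_f L u + \<theta>) u)) \<in> borel_measurable borel"
    unfolding box_avg_def set_lebesgue_integral_def
  proof (intro borel_measurable_divide lborel.borel_measurable_lebesgue_integral borel_measurable_const)
    show "(\<lambda>(\<theta>, u). indicator {x - s..x + s} u *\<^sub>R R (std_f L u + \<theta>) u) \<in> borel_measurable (borel \<Otimes>\<^sub>M lborel)"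
      unfolding measurable_cong_sets[OF sets_pair_measure_cong[OF refl sets_lborel] refl] split_beta
      by (intro borel_measurable_scaleR mR) measurable
  qed
  have bA: "\<bar>box_avg s x (\<lambda>u. R (std_f L u + \<theta>) u)\<bar> \<le> B" for \<theta>
    by (rule box_avg_abs_le[OF s(1) mGu B])
  \<comment> \<open>For each fixed u the integral over \<theta> covers a full period, whatever the
    starting value f(u).\<close>
  have "box_avg s x (\<lambda>u. LBINT c:{0..1}. R c u) = box_avg s x (\<lambda>u. LBINT \<theta>:{0..1}. R (std_f L u + \<theta>) u)"
  proof -
    have "(LBINT \<theta>:{0..1}. R (\<theta> + std_f L u) u) = (LBINT c:{0..1}. R c u)" for u
      by (rule set_integral_periodic[where B=B]) (auto intro!: mR simp: B per)
    then show ?thesis by (simp add: add.commute)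
  qed
  also have "\<dots> = (LBINT \<theta>:{0..1}. box_avg s x (\<lambda>u. R (std_f L u + \<theta>) u))"
    unfolding box_avg_def using s
    by (subst set_integral_Icc_swap[OF mG, where B=B, symmetric]) (auto simp: B)
  finally have eq: "box_avg s x (\<lambda>u. LBINT c:{0..1}. R c u) = (LBINT \<theta>:{0..1}. box_avg s x (\<lambda>u. R (std_f L u + \<theta>) u))" .
  have "(LBINT \<theta>:{0..1::real}. box_avg s x (\<lambda>u. R (std_f L u + \<theta>) u) - box_avg s x (\<lambda>u. R (std_f L u) u))
      = (LBINT \<theta>:{0..1}. box_avg s x (\<lambda>u. R (std_f L u + \<theta>) u)) - box_avg s x (\<lambda>u. R (std_f L u) u)"
    using set_integrable_Icc_bounded[OF mA bA, of 0 1]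
      set_integrable_Icc_bounded[of "\<lambda>_. box_avg s x (\<lambda>u. R (std_f L u) u)" 0 1]
    by (subst set_integral_diff) (auto simp: set_integral_const)
  moreover have "\<bar>LBINT \<theta>:{0..1::real}. box_avg s x (\<lambda>u. R (std_f L u + \<theta>) u) - box_avg s x (\<lambda>u. R (std_f L u) u)\<bar> \<le> ?e * (1 - 0)"
    using shift mA by (intro set_integral_Icc_bound) auto
  ultimately show ?thesis unfolding eq diff_zero mult_1_right by linarith
qed

section \<open>Six steps of the projective process\<close>

lemma measurable_abs_torus: "abs_torus \<in> borel_measurable borel"
  by (rule borel_measurable_continuous_onI[OF continuous_abs_torus])

lemma measurable_bundle_point:
  assumes a: "a \<in> borel_measurable M" and b: "b \<in> borel_measurable M"
    and c: "c \<in> borel_measurable M" and d: "d \<in> borel_measurable M"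
    and nz: "\<And>w. (c w, d w) \<noteq> (0, 0)"
  shows "(\<lambda>w. (tor (a w) (b w), line_of (c w, d w)) :: proj_bundle) \<in> borel_measurable M"
proof -
  have "(\<lambda>w. (c w, d w)) \<in> M \<rightarrow>\<^sub>M restrict_space borel (- {0})"
    using c d nz by (intro measurable_restrict_space2) (auto simp: zero_prod_def)
  then have l: "(\<lambda>w. line_of (c w, d w)) \<in> borel_measurable M"
    using borel_measurable_continuous_on_restrict[OF continuous_line_of] by (rule measurable_compose)
  have t: "(\<lambda>w. tor (a w) (b w)) \<in> borel_measurable M"
    using a b by (intro measurable_compose[OF _ measurable_abs_torus]) measurable
  from measurable_Pair[OF t l] show ?thesis by (simp add: borel_prod)
qed

lemma tor_add_int: "tor (x + of_int n) y = tor x y" "tor x (y + of_int n) = tor x y"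
  by (auto simp: abs_torus_eq_iff torus_rel_def)

lemma std_f_lipschitz:
  assumes "0 \<le> L"
  shows "\<bar>std_f L u - std_f L u'\<bar> \<le> 2 * pi * L * \<bar>u - u'\<bar>"
proof -
  have d: "(std_f L has_field_derivative dstd_f L z) (at z within UNIV)" for z
    unfolding std_f_def[abs_def] dstd_f_def by (auto intro!: derivative_eq_intros)
  have "\<bar>dstd_f L z\<bar> \<le> 2 * pi * L" for z
    using mult_left_mono[OF abs_sin_le_one[of "2 * pi * z"], of "2 * pi * L"] assms
    by (simp add: dstd_f_def abs_mult)
  then show ?thesis
    using field_differentiable_bound[of UNIV "std_f L" "dstd_f L" "2 * pi * L" u u'] d by simp
qed

section \<open>The cone of nearly horizontal lines\<close>

text \<open>The cone of slopes at most \<rho> about the direction (1, 0), whose image is (f'(u), 1).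
  The homogeneous inequality includes all directions without a division.\<close>

definition good_lines :: "real \<Rightarrow> proj_line set" where
  "good_lines \<rho> = {l. \<exists>v. v \<noteq> 0 \<and> l = line_of v \<and> \<bar>snd v\<bar> \<le> \<rho> * \<bar>fst v\<bar>}"

lemma line_of_good_iff:
  assumes "v \<noteq> 0"
  shows "line_of v \<in> good_lines \<rho> \<longleftrightarrow> \<bar>snd v\<bar> \<le> \<rho> * \<bar>fst v\<bar>"
proof
  assume "line_of v \<in> good_lines \<rho>"
  then obtain u where u: "u \<noteq> 0" "line_of v = line_of u" "\<bar>snd u\<bar> \<le> \<rho> * \<bar>fst u\<bar>"
    by (auto simp: good_lines_def)
  then obtain c where "v = c *\<^sub>R u" using line_of_eqD assms by metis
  then show "\<bar>snd v\<bar> \<le> \<rho> * \<bar>fst v\<bar>"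
    using mult_left_mono[OF u(3), of "\<bar>c\<bar>"] by (simp add: abs_mult mult.left_commute)
next
  assume "\<bar>snd v\<bar> \<le> \<rho> * \<bar>fst v\<bar>"
  then show "line_of v \<in> good_lines \<rho>"
    unfolding good_lines_def using assms by (intro CollectI exI[of _ v]) simp
qed

lemma good_lineE:
  assumes "l \<in> good_lines \<rho>" "0 \<le> \<rho>"
  obtains r where "\<bar>r\<bar> \<le> \<rho>" "l = line_of (1, r)"
proof -
  obtain a b where ab: "(a, b) \<noteq> 0" "l = line_of (a, b)" "\<bar>b\<bar> \<le> \<rho> * \<bar>a\<bar>"
    using assms by (auto simp: good_lines_def)
  then have "a \<noteq> 0" by (auto simp: zero_prod_def)
  then have "line_of (a, b) = line_of (1, b / a)"
    using line_of_scaleR[of a "(1, b / a)"] by (simp add: zero_prod_def)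
  moreover have "\<bar>b / a\<bar> \<le> \<rho>" using ab(3) \<open>a \<noteq> 0\<close> by (simp add: abs_divide pos_divide_le_eq)
  ultimately show ?thesis using that ab by metis
qed

definition bad_points :: "real \<Rightarrow> proj_bundle set" where
  "bad_points \<rho> = UNIV \<times> (- good_lines \<rho>)"

text \<open>The complement of the cone is the image of an open set of vectors under the open map
  \<open>line_of\<close>.\<close>

lemma sets_bad_points: "0 \<le> \<rho> \<Longrightarrow> bad_points \<rho> \<in> sets borel"
proof -
  assume "0 \<le> \<rho>"
  let ?V = "{v :: real \<times> real. \<rho> * \<bar>fst v\<bar> < \<bar>snd v\<bar>}"
  have "open ?V" by (intro open_Collect_less continuous_intros)
  moreover have "?V \<subseteq> - {0}" by auto
  ultimately have "open (line_of ` ?V)" by (rule open_map_line_of)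
  moreover have "- good_lines \<rho> = line_of ` ?V"
  proof (intro set_eqI iffI)
    fix l assume l: "l \<in> - good_lines \<rho>"
    obtain v where v: "l = line_of v" "v \<noteq> 0" by (rule line_of_surj)
    then have "v \<in> ?V" using l line_of_good_iff[of v \<rho>] by auto
    then show "l \<in> line_of ` ?V" using v(1) by (rule image_eqI[rotated])
  next
    fix l assume "l \<in> line_of ` ?V"
    then obtain v where v: "v \<in> ?V" "l = line_of v" by (rule imageE)
    then have "v \<noteq> 0" using \<open>?V \<subseteq> - {0}\<close> by auto
    then show "l \<in> - good_lines \<rho>" using v line_of_good_iff[of v \<rho>] by auto
  qed
  ultimately have "open (bad_points \<rho>)" unfolding bad_points_def by (intro open_Times) auto
  then show ?thesis by simp
qed

text \<open>L and \<sigma> are independent parameters here; their relation through \<delta> enters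
  only when the errors are balanced. The bound 1/4 limits a noise window to two branches of the
  sine.\<close>

locale random_standard_map =
  fixes L \<sigma> :: real
  assumes L: "1 \<le> L" and \<sigma>: "0 < \<sigma>" "\<sigma> \<le> 1 / 4"

sublocale random_standard_map \<subseteq> random_map "uniform_measure lborel {- \<sigma>..\<sigma>}" "proj_step L"
proof -
  interpret prob_space "uniform_measure lborel {- \<sigma>..\<sigma>}"
    using \<sigma> by (intro prob_space_uniform_Icc) auto
  have *: "sets (uniform_measure lborel {- \<sigma>..\<sigma>}) = sets borel" by simp
  show "random_map (uniform_measure lborel {- \<sigma>..\<sigma>}) (proj_step L)"
  proof
    show "(\<lambda>(w, z). proj_step L w z) \<in> uniform_measure lborel {- \<sigma>..\<sigma>} \<Otimes>\<^sub>M borel \<rightarrow>\<^sub>M borel"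
      unfolding measurable_cong_sets[OF sets_pair_measure_cong[OF * refl] refl]
      by (rule measurable_proj_step)
  qed
qed

context random_standard_map
begin

lemma image_vector_nz: "v \<noteq> 0 \<Longrightarrow> (dstd_f L u * fst v - snd v, fst v) \<noteq> (0, 0)"
  by (cases v) (auto simp: zero_prod_def)

lemma measurable_image_observable:
  assumes "bounded_borel B \<phi>" "v \<noteq> 0"
  shows "(\<lambda>u. \<phi> (tor (std_f L u - y) u, line_of (dstd_f L u * fst v - snd v, fst v))) \<in> borel_measurable borel"
  using image_vector_nz[OF assms(2)]
  by (intro measurable_compose[OF _ bounded_borelD(1)[OF assms(1)]] measurable_bundle_point) auto

lemma markov_lift:
  assumes "bounded_borel B \<phi>" "v \<noteq> 0"
  shows "markov \<phi> (tor x y, line_of v)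
    = box_avg \<sigma> x (\<lambda>u. \<phi> (tor (std_f L u - y) u, line_of (dstd_f L u * fst v - snd v, fst v)))"
  using box_avg_uniform[OF \<sigma>(1) measurable_image_observable[OF assms], of x y]
  by (simp add: markov_def proj_step_lift[OF assms(2)])

section \<open>Regularity gained from the noise\<close>

text \<open>At fixed y and line, x enters only as the centre of the window.\<close>

lemma markov_lipschitz_fst:
  assumes "bounded_borel B \<phi>"
  shows "\<bar>markov \<phi> (tor x y, l) - markov \<phi> (tor x' y, l)\<bar> \<le> B / \<sigma> * \<bar>x - x'\<bar>"
proof -
  obtain v where v: "l = line_of v" "v \<noteq> 0" by (rule line_of_surj)
  show ?thesis
    unfolding v(1) markov_lift[OF assms v(2)]
    by (intro box_avg_lipschitz \<sigma> measurable_image_observable[OF assms v(2)] bounded_borelD(2)[OF assms])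
qed

text \<open>Since y is seen only through the new first coordinate f(u) - y, Lipschitz dependence on
  x becomes Lipschitz dependence on y one step later, with the same constant.\<close>

lemma markov_lipschitz_snd:
  assumes "bounded_borel B \<phi>" and K: "\<And>x x' y l. \<bar>\<phi> (tor x y, l) - \<phi> (tor x' y, l)\<bar> \<le> K * \<bar>x - x'\<bar>"
  shows "\<bar>markov \<phi> (tor x y, l) - markov \<phi> (tor x y', l)\<bar> \<le> K * \<bar>y - y'\<bar>"
proof -
  obtain v where v: "l = line_of v" "v \<noteq> 0" by (rule line_of_surj)
  have "\<bar>\<phi> (tor (std_f L u - y) u, l) - \<phi> (tor (std_f L u - y') u, l)\<bar> \<le> K * \<bar>y - y'\<bar>" for u l
    using K[of "std_f L u - y" u l "std_f L u - y'"] by (simp add: abs_minus_commute)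
  then show ?thesis
    unfolding v(1) markov_lift[OF assms(1) v(2)]
    by (intro box_avg_diff_le[OF \<sigma>(1), where B=B and C=B] measurable_image_observable[OF assms(1) v(2)]
        bounded_borelD(2)[OF assms(1)])
qed

lemma markov2_lipschitz:
  assumes "bounded_borel B \<phi>"
  shows "\<bar>markov (markov \<phi>) (tor x y, l) - markov (markov \<phi>) (tor x' y', l)\<bar> \<le> B / \<sigma> * (\<bar>x - x'\<bar> + \<bar>y - y'\<bar>)"
  using markov_lipschitz_fst[OF bounded_borel_markov[OF assms], of x y l x']
    markov_lipschitz_snd[OF bounded_borel_markov[OF assms] markov_lipschitz_fst[OF assms], of x' y l y']
  by (simp add: distrib_left)

text \<open>The image of (1, q) leaves the cone only if |f'(u) - q| < 1/\<rho>, which confines sin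
  (2 pi u) to an interval of half-width 1/(2 pi L \<rho>). The bound is uniform over all starting
  lines.\<close>

lemma markov_bad_points:
  assumes \<kappa>: "0 < \<kappa>" "\<kappa> \<le> 1 / 6" and \<rho>: "0 < \<rho>"
  shows "markov (indicator (bad_points \<rho>)) z \<le> (1 / (L * \<rho> * \<kappa>) + 2 * \<kappa>) / \<sigma>"
proof -
  obtain x y l where z: "z = (tor x y, l)" by (metis abs_torus_surj surj_pair)
  obtain v where v: "l = line_of v" "v \<noteq> 0" by (rule line_of_surj)
  have b: "bounded_borel 1 (indicator (bad_points \<rho>) :: proj_bundle \<Rightarrow> real)"
    using sets_bad_points[of \<rho>] \<rho> by (auto simp: bounded_borel_def indicator_def)
  let ?g = "\<lambda>u. indicator (bad_points \<rho>) (tor (std_f L u - y) u, line_of (dstd_f L u * fst v - snd v, fst v)) :: real"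
  have m: "?g \<in> borel_measurable borel" by (rule measurable_image_observable[OF b v(2)])
  have g: "?g u = (if \<rho> * \<bar>dstd_f L u * fst v - snd v\<bar> < \<bar>fst v\<bar> then 1 else 0)" for u
    using line_of_good_iff[of "(dstd_f L u * fst v - snd v, fst v)" \<rho>] image_vector_nz[OF v(2), of u]
    by (auto simp: bad_points_def zero_prod_def indicator_def)
  have pos: "0 \<le> (1 / (L * \<rho> * \<kappa>) + 2 * \<kappa>) / \<sigma>" using L \<rho> \<kappa> \<sigma> by simp
  show ?thesis
  proof (cases "fst v = 0")
    \<comment> \<open>A vertical direction has a horizontal image, which lies in the cone for every
      u.\<close>
    case True
    then have "?g = (\<lambda>u. 0)" using g \<rho> by (auto simp: fun_eq_iff mult_less_0_iff)
    then show ?thesis using pos by (simp add: z v(1) markov_lift[OF b v(2)] box_avg_const \<sigma>(1))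
  next
    case False
    \<comment> \<open>Chosen so that -r is the value of the sine at which the image line is
      vertical.\<close>
    define r where "r = snd v / (2 * pi * L * fst v)"
    let ?\<rho>' = "1 / (2 * pi * L * \<rho>)"
    let ?h = "\<lambda>u. indicator {y. \<bar>y + r\<bar> \<le> ?\<rho>'} (sin (2 * pi * u)) :: real"
    have c: "0 < 2 * pi * L" using L by simp
    have gh: "?g u \<le> ?h u" for u
    proof -
      have "\<bar>sin (2 * pi * u) + r\<bar> \<le> ?\<rho>'" if *: "\<rho> * \<bar>dstd_f L u * fst v - snd v\<bar> < \<bar>fst v\<bar>"
      proof -
        have "dstd_f L u * fst v - snd v = - (2 * pi * L) * fst v * (sin (2 * pi * u) + r)"
          using False L by (simp add: dstd_f_def r_def field_simps)
        then have "\<rho> * \<bar>dstd_f L u * fst v - snd v\<bar> = (2 * pi * L * \<rho>) * \<bar>sin (2 * pi * u) + r\<bar> * \<bar>fst v\<bar>"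
          using c L by (simp add: abs_mult)
        with * have "(2 * pi * L * \<rho>) * \<bar>sin (2 * pi * u) + r\<bar> * \<bar>fst v\<bar> < 1 * \<bar>fst v\<bar>" by simp
        then have "(2 * pi * L * \<rho>) * \<bar>sin (2 * pi * u) + r\<bar> < 1"
          by (rule mult_right_less_imp_less) simp
        moreover have "0 < 2 * pi * L * \<rho>" using c \<rho> by simp
        ultimately show ?thesis by (simp add: field_simps)
      qed
      then show ?thesis unfolding g by (auto simp: indicator_def)
    qed
    have "markov (indicator (bad_points \<rho>)) z = box_avg \<sigma> x ?g"
      unfolding z v(1) by (rule markov_lift[OF b v(2)])
    also have "\<dots> \<le> box_avg \<sigma> x ?h"
      by (rule box_avg_mono[OF \<sigma>(1) m _ _ _ gh, where B=1 and C=1]) (auto simp: indicator_def)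
    also have "\<dots> \<le> (4 * ?\<rho>' / \<kappa> + 4 * \<kappa>) / (2 * \<sigma>)"
      unfolding box_avg_def using \<sigma> c \<rho>
      by (intro divide_right_mono sin_sublevel \<kappa>) auto
    also have "\<dots> \<le> (2 * (1 / (L * \<rho> * \<kappa>) + 2 * \<kappa>)) / (2 * \<sigma>)"
    proof -
      have "4 * ?\<rho>' / \<kappa> = 2 / pi * (1 / (L * \<rho> * \<kappa>))" by (simp add: field_simps)
      also have "\<dots> \<le> 2 * (1 / (L * \<rho> * \<kappa>))"
        using pi_gt3 L \<rho> \<kappa> by (intro mult_right_mono) (auto simp: field_simps)
      finally show ?thesis using \<sigma> by (intro divide_right_mono) auto
    qed
    also have "\<dots> = (1 / (L * \<rho> * \<kappa>) + 2 * \<kappa>) / \<sigma>" by (rule mult_divide_mult_cancel_left) simp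
    finally show ?thesis .
  qed
qed

section \<open>Forgetting the direction and the position\<close>

lemma markov3_slope:
  assumes b: "bounded_borel B \<phi>" and \<kappa>: "0 < \<kappa>" "\<kappa> \<le> 1 / 6" and r: "\<bar>r\<bar> \<le> \<rho>"
  shows "\<bar>(markov ^^ 3) \<phi> (t, line_of (1, r)) - (markov ^^ 3) \<phi> (t, line_of (1, 0))\<bar>
    \<le> B * (12 * \<rho> / (\<sigma>\<^sup>2 * \<kappa> ^ 3) + 4 * \<kappa> / \<sigma>)"
proof -
  obtain x y where t: "t = tor x y" by (rule abs_torus_surj)
  note B0 = bounded_borel_nonneg[OF b]
  let ?Q = "markov (markov \<phi>)"
  have bQ: "bounded_borel B ?Q" using b by (intro bounded_borel_markov)
  \<comment> \<open>The base point stays a function of u and only the line is expressed through s: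
    \<open>?Q\<close> is Lipschitz in the base point by \<open>markov2_lipschitz\<close>, while its
    dependence on the line is merely measurable.\<close>
  define H where "H u s = ?Q (tor (std_f L u - y) u, line_of (- (2 * pi * L * s), 1))" for u s
  have mH: "case_prod H \<in> borel_measurable (borel \<Otimes>\<^sub>M borel)"
    unfolding H_def split_beta
    by (intro measurable_compose[OF _ bounded_borelD(1)[OF bQ]] measurable_bundle_point) auto
  define K where "K = B / \<sigma> * (2 * pi * L + 1)"
  have K: "\<bar>H u s - H u' s\<bar> \<le> K * \<bar>u - u'\<bar>" for u u' s
  proof -
    have "\<bar>H u s - H u' s\<bar> \<le> B / \<sigma> * (\<bar>(std_f L u - y) - (std_f L u' - y)\<bar> + \<bar>u - u'\<bar>)"
      unfolding H_def by (rule markov2_lipschitz[OF b])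
    also have "\<dots> \<le> B / \<sigma> * (2 * pi * L * \<bar>u - u'\<bar> + \<bar>u - u'\<bar>)"
      using std_f_lipschitz[of L u u'] L B0 \<sigma> by (intro mult_left_mono) auto
    finally show ?thesis by (simp add: K_def algebra_simps)
  qed
  have c: "0 < 2 * pi * L" using L by simp
  let ?\<epsilon> = "r / (2 * pi * L)"
  have "(markov ^^ 3) \<phi> (t, line_of (1, q)) = box_avg \<sigma> x (\<lambda>u. H u (sin (2 * pi * u) + q / (2 * pi * L)))" for q
  proof -
    have "(markov ^^ 3) \<phi> (t, line_of (1, q)) = markov ?Q (tor x y, line_of (1, q))"
      by (simp add: numeral_3_eq_3 t)
    also have "\<dots> = box_avg \<sigma> x (\<lambda>u. ?Q (tor (std_f L u - y) u, line_of (dstd_f L u * 1 - q, 1)))"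
      using markov_lift[OF bQ, of "(1, q)" x y] by (simp add: zero_prod_def)
    also have "(\<lambda>u. ?Q (tor (std_f L u - y) u, line_of (dstd_f L u * 1 - q, 1)))
        = (\<lambda>u. H u (sin (2 * pi * u) + q / (2 * pi * L)))"
    proof
      fix u
      have "dstd_f L u * 1 - q = - (2 * pi * L * (sin (2 * pi * u) + q / (2 * pi * L)))"
        using L by (simp add: dstd_f_def distrib_left)
      then show "?Q (tor (std_f L u - y) u, line_of (dstd_f L u * 1 - q, 1)) = H u (sin (2 * pi * u) + q / (2 * pi * L))"
        by (simp only: H_def)
    qed
    finally show ?thesis .
  qed
  from this[of r] this[of 0]
  have "\<bar>(markov ^^ 3) \<phi> (t, line_of (1, r)) - (markov ^^ 3) \<phi> (t, line_of (1, 0))\<bar>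
      \<le> (6 * (B + K) * \<bar>?\<epsilon>\<bar> / \<kappa> ^ 3 + 4 * B * \<kappa>) / \<sigma>"
    using box_avg_sin_shift[OF \<sigma> mH _ K \<kappa>, of B x ?\<epsilon>] bounded_borelD(2)[OF bQ]
    by (simp add: H_def)
  \<comment> \<open>The Lipschitz constant K has order L/\<sigma>; \<sigma> + 2 pi L + 1 \<le> 4 pi
    L merges it with B, and then L cancels against the size of the shift.\<close>
  also have "\<dots> \<le> (6 * (2 * B * (2 * pi * L) / \<sigma>) * (\<rho> / (2 * pi * L)) / \<kappa> ^ 3 + 4 * B * \<kappa>) / \<sigma>"
  proof -
    have "1 \<le> pi * L" using mult_mono[of 1 pi 1 L] L pi_gt3 by simp
    then have "\<sigma> + (2 * pi * L + 1) \<le> 2 * (2 * pi * L)" using \<sigma> by (simp add: algebra_simps)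
    then have "B * (\<sigma> + (2 * pi * L + 1)) / \<sigma> \<le> B * (2 * (2 * pi * L)) / \<sigma>"
      using B0 \<sigma> by (intro divide_right_mono mult_left_mono) auto
    then have "B + K \<le> 2 * B * (2 * pi * L) / \<sigma>"
      using \<sigma> by (simp add: K_def field_simps)
    moreover have "\<bar>?\<epsilon>\<bar> \<le> \<rho> / (2 * pi * L)"
      using r c by (simp add: abs_divide divide_right_mono)
    moreover have "0 \<le> K" using B0 \<sigma> c by (simp add: K_def)
    ultimately show ?thesis
      using B0 \<sigma> \<kappa> c by (intro divide_right_mono add_mono mult_mono) auto
  qed
  also have "\<dots> = B * (12 * \<rho> / (\<sigma>\<^sup>2 * \<kappa> ^ 3) + 4 * \<kappa> / \<sigma>)"
    using \<sigma> L \<kappa> by (simp add: field_simps power2_eq_square)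
  finally show ?thesis .
qed

text \<open>The coordinates are averaged out one at a time. After the first step P\<psi> is
  Lipschitz in its second coordinate; equidistribution of f(u) - y in the next step removes y and
  leaves a function A of x alone; one more equidistribution, of f(u) - y inside A, removes
  x.\<close>

lemma markov3_torus:
  assumes b: "bounded_borel B \<psi>" and \<kappa>: "0 < \<kappa>" "\<kappa> \<le> 1 / 6"
    and indep: "\<And>t l l'. \<psi> (t, l) = \<psi> (t, l')"
    and K: "\<And>x x' y l. \<bar>\<psi> (tor x y, l) - \<psi> (tor x' y, l)\<bar> \<le> B / \<sigma> * \<bar>x - x'\<bar>"
  shows "\<exists>c. \<forall>z. \<bar>(markov ^^ 3) \<psi> z - c\<bar> \<le> 2 * (B * (12 / (\<sigma>\<^sup>2 * L * \<kappa> ^ 3) + 4 * \<kappa> / \<sigma>))"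
proof -
  let ?e = "B * (12 / (\<sigma>\<^sup>2 * L * \<kappa> ^ 3) + 4 * \<kappa> / \<sigma>)"
  let ?l = "line_of (1, 0)"
  note B0 = bounded_borel_nonneg[OF b]
  have indep1: "markov \<psi>' (t, l) = markov \<psi>' (t, l')"
    if b': "bounded_borel B \<psi>'" and ind: "\<And>t l l'. \<psi>' (t, l) = \<psi>' (t, l')" for \<psi>' t l l'
  proof -
    obtain x y where t: "t = tor x y" by (rule abs_torus_surj)
    obtain v where v: "l = line_of v" "v \<noteq> 0" by (rule line_of_surj)
    obtain v' where v': "l' = line_of v'" "v' \<noteq> 0" by (rule line_of_surj)
    show ?thesis
      unfolding t v(1) v'(1) markov_lift[OF b' v(2)] markov_lift[OF b' v'(2)]
      by (intro arg_cong[where f="box_avg \<sigma> x"] ext ind)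
  qed
  have lift: "markov \<psi>' (tor x y, l) = box_avg \<sigma> x (\<lambda>u. \<psi>' (tor (std_f L u - y) u, ?l))"
    if b': "bounded_borel B \<psi>'" and ind: "\<And>t l l'. \<psi>' (t, l) = \<psi>' (t, l')" for \<psi>' x y l
  proof -
    obtain v where v: "l = line_of v" "v \<noteq> 0" by (rule line_of_surj)
    show ?thesis
      unfolding v(1) markov_lift[OF b' v(2)] by (intro arg_cong[where f="box_avg \<sigma> x"] ext ind)
  qed
  let ?P = "markov \<psi>"
  have bP: "bounded_borel B ?P" and bPP: "bounded_borel B (markov ?P)"
    using b by (auto intro: bounded_borel_markov)
  note iP = indep1[OF b indep]
  note iPP = indep1[OF bP iP]
  have mobs: "(\<lambda>w. \<phi> (tor (a w) (b w), ?l)) \<in> borel_measurable M"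
    if "bounded_borel B \<phi>" "a \<in> borel_measurable M" "b \<in> borel_measurable M" for \<phi> a b M
    using that by (intro measurable_compose[OF _ bounded_borelD(1)[OF that(1)]] measurable_bundle_point) auto
  \<comment> \<open>One error bound serves both uses of equidistribution, with K' = B/\<sigma> and
    K' = 0; as \<sigma> \<le> 1, also B \<le> B/\<sigma>.\<close>
  have est: "(6 * (B + K') / (L * \<kappa> ^ 3) + 4 * B * \<kappa>) / \<sigma> \<le> ?e" if "K' \<le> B / \<sigma>" for K'
  proof -
    have "B * 1 \<le> B * (1 / \<sigma>)" using B0 \<sigma> by (intro mult_left_mono) auto
    then have "B + K' \<le> 2 * (B / \<sigma>)" using that by simp
    then have "(6 * (B + K') / (L * \<kappa> ^ 3) + 4 * B * \<kappa>) / \<sigma> \<le> (6 * (2 * (B / \<sigma>)) / (L * \<kappa> ^ 3) + 4 * B * \<kappa>) / \<sigma>"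
      using L \<sigma> \<kappa> B0 by (intro divide_right_mono add_mono mult_left_mono) auto
    also have "\<dots> = ?e" using L \<sigma> \<kappa> by (simp add: field_simps power2_eq_square)
    finally show ?thesis .
  qed
  \<comment> \<open>The first coordinate integrated over a period. The remaining u is the old x plus
    noise, so averaging \<open>N\<close> over the window gives a function of x alone.\<close>
  define N where "N u = (LBINT c:{0..1}. ?P (tor c u, ?l))" for u
  have mN: "N \<in> borel_measurable borel"
    unfolding N_def[abs_def] set_lebesgue_integral_def
  proof (rule lborel.borel_measurable_lebesgue_integral)
    show "(\<lambda>(u, c). indicator {0..1} c *\<^sub>R ?P (tor c u, ?l)) \<in> borel_measurable (borel \<Otimes>\<^sub>M lborel)"
      unfolding measurable_cong_sets[OF sets_pair_measure_cong[OF refl sets_lborel] refl] split_beta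
      by (intro borel_measurable_scaleR mobs[OF bP]) measurable
  qed
  have bN: "\<bar>N u\<bar> \<le> B" for u
    using set_integral_Icc_bound[of "\<lambda>c. ?P (tor c u, ?l)" 0 1 B] mobs[OF bP, of "\<lambda>c. c" borel "\<lambda>c. u"]
      bounded_borelD(2)[OF bP] by (simp add: N_def)
  have N_per: "N (u + of_int n) = N u" for u n by (simp add: N_def tor_add_int)
  define A where "A x = box_avg \<sigma> x N" for x
  have A_per: "A (x + of_int n) = A x" for x n
    using set_integral_Icc_shift[of "x - \<sigma>" "of_int n" "x + \<sigma>" N]
    by (simp add: A_def box_avg_def N_per algebra_simps)
  have mA: "A \<in> borel_measurable borel"
    unfolding A_def[abs_def]
    by (rule borel_measurable_continuous_onI[OF continuous_on_box_avg[OF \<sigma>(1) mN bN]])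
  have bA: "\<bar>A x\<bar> \<le> B" for x unfolding A_def by (rule box_avg_abs_le[OF \<sigma>(1) mN bN])
  have two: "\<bar>markov ?P (tor x y, l) - A x\<bar> \<le> ?e" for x y l
  proof -
    define R where "R c u = ?P (tor (c - y) u, ?l)" for c u
    have mR: "case_prod R \<in> borel_measurable (borel \<Otimes>\<^sub>M borel)"
      unfolding R_def split_beta by (intro mobs[OF bP]) auto
    have "R (c + of_int n) u = R c u" for c n u
      using tor_add_int(1)[of "c - y" n u] by (simp add: R_def algebra_simps)
    \<comment> \<open>One step turns the Lipschitz dependence of \<open>\<psi>\<close> on the first coordinate into one on the second,
      which is the slow variable here.\<close>
    moreover have "\<bar>R c u - R c u'\<bar> \<le> B / \<sigma> * \<bar>u - u'\<bar>" for c u u'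
      unfolding R_def by (rule markov_lipschitz_snd[OF b K])
    ultimately have "\<bar>box_avg \<sigma> x (\<lambda>u. R (std_f L u) u) - box_avg \<sigma> x (\<lambda>u. LBINT c:{0..1}. R c u)\<bar>
        \<le> (6 * (B + B / \<sigma>) / (L * \<kappa> ^ 3) + 4 * B * \<kappa>) / \<sigma>"
      using L bounded_borelD(2)[OF bP] by (intro cos_equidistribution \<sigma> \<kappa> mR) (auto simp: R_def)
    moreover have "(LBINT c:{0..1}. R c u) = N u" for u
      using set_integral_periodic[of "\<lambda>c. ?P (tor c u, ?l)" B "- y"] mobs[OF bP, of "\<lambda>c. c" borel "\<lambda>c. u"]
        bounded_borelD(2)[OF bP] by (simp add: N_def R_def tor_add_int)
    moreover have "markov ?P (tor x y, l) = box_avg \<sigma> x (\<lambda>u. R (std_f L u) u)"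
      unfolding R_def by (rule lift[OF bP iP])
    ultimately show ?thesis using est[OF order_refl] by (simp add: A_def)
  qed
  define C where "C = (LBINT c:{0..1}. A c)"
  have "\<bar>markov (markov ?P) z - C\<bar> \<le> 2 * ?e" for z
  proof -
    obtain x y l where z: "z = (tor x y, l)" by (metis abs_torus_surj surj_pair)
    have "markov (markov ?P) z = box_avg \<sigma> x (\<lambda>u. markov ?P (tor (std_f L u - y) u, ?l))"
      unfolding z by (rule lift[OF bPP iPP])
    moreover have "\<bar>box_avg \<sigma> x (\<lambda>u. markov ?P (tor (std_f L u - y) u, ?l)) - box_avg \<sigma> x (\<lambda>u. A (std_f L u - y))\<bar> \<le> ?e"
    proof (rule box_avg_diff_le[OF \<sigma>(1), where B=B and C=B])
      show "(\<lambda>u. A (std_f L u - y)) \<in> borel_measurable borel"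
        by (rule measurable_compose[OF _ mA]) measurable
    qed (auto intro!: mobs[OF bPP] bounded_borelD(2)[OF bPP] bA two)
    moreover have "\<bar>box_avg \<sigma> x (\<lambda>u. A (std_f L u - y)) - C\<bar> \<le> ?e"
    proof -
      \<comment> \<open>The observable now depends on the fast variable only, so its Lipschitz
        constant in u is 0.\<close>
      have "case_prod (\<lambda>c u. A (c - y)) \<in> borel_measurable (borel \<Otimes>\<^sub>M borel)"
        unfolding split_beta by (rule measurable_compose[OF _ mA]) measurable
      moreover have "A (c + of_int n - y) = A (c - y)" for c n
        using A_per[of "c - y" n] by (simp add: algebra_simps)
      ultimately have "\<bar>box_avg \<sigma> x (\<lambda>u. A (std_f L u - y)) - box_avg \<sigma> x (\<lambda>u. LBINT c:{0..1}. A (c - y))\<bar>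
          \<le> (6 * (B + 0) / (L * \<kappa> ^ 3) + 4 * B * \<kappa>) / \<sigma>"
        using L bA by (intro cos_equidistribution[where R="\<lambda>c u. A (c - y)"] \<sigma> \<kappa>) auto
      moreover have "(LBINT c:{0..1}. A (c - y)) = C"
        using set_integral_periodic[OF mA bA A_per, of "- y"] by (simp add: C_def)
      moreover have "0 \<le> B / \<sigma>" using B0 \<sigma> by simp
      ultimately show ?thesis using est[of 0] by (simp add: box_avg_const \<sigma>(1))
    qed
    ultimately show ?thesis by linarith
  qed
  then show ?thesis by (auto simp: numeral_3_eq_3)
qed

text \<open>In the order of time, the first three steps bring the line into the cone with high
  probability, and the last three, hidden in \<open>?F\<close>, then forget it. On the cone
  \<open>?F\<close> is close to \<psi>, which ignores the line, and the first three steps make the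
  average of \<psi> nearly constant.\<close>

lemma markov6_oscillation:
  assumes b: "bounded_borel B \<phi>" and \<kappa>: "0 < \<kappa>" "\<kappa> \<le> 1 / 6" and \<rho>: "0 < \<rho>"
  shows "\<bar>(markov ^^ 6) \<phi> z - (markov ^^ 6) \<phi> z'\<bar>
    \<le> B * (24 * \<rho> / (\<sigma>\<^sup>2 * \<kappa> ^ 3) + 4 / (L * \<rho> * \<kappa> * \<sigma>) + 48 / (\<sigma>\<^sup>2 * L * \<kappa> ^ 3) + 32 * \<kappa> / \<sigma>)"
proof -
  note B0 = bounded_borel_nonneg[OF b]
  let ?F = "(markov ^^ 3) \<phi>"
  have bF: "bounded_borel B ?F" using b by (rule bounded_borel_markov_pow)
  define \<psi> :: "proj_bundle \<Rightarrow> real" where "\<psi> p = ?F (fst p, line_of (1, 0))" for p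
  have "(\<lambda>p::proj_bundle. (fst p, line_of (1, 0))) \<in> borel_measurable borel"
    by (intro borel_measurable_continuous_onI continuous_intros)
  then have b\<psi>: "bounded_borel B \<psi>"
    using measurable_compose[OF _ bounded_borelD(1)[OF bF]] bounded_borelD(2)[OF bF]
    by (auto simp: bounded_borel_def \<psi>_def[abs_def])
  let ?e1 = "B * (12 * \<rho> / (\<sigma>\<^sup>2 * \<kappa> ^ 3) + 4 * \<kappa> / \<sigma>)"
  let ?e2 = "(1 / (L * \<rho> * \<kappa>) + 2 * \<kappa>) / \<sigma>"
  let ?e3 = "2 * (B * (12 / (\<sigma>\<^sup>2 * L * \<kappa> ^ 3) + 4 * \<kappa> / \<sigma>))"
  have e1: "0 \<le> ?e1" using B0 \<rho> \<sigma> \<kappa> by simp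
  let ?I = "indicator (bad_points \<rho>) :: proj_bundle \<Rightarrow> real"
  have bI: "bounded_borel 1 ?I"
    using sets_bad_points[of \<rho>] \<rho> by (auto simp: bounded_borel_def indicator_def)
  have near: "\<bar>?F p - \<psi> p\<bar> \<le> ?e1 + 2 * B * ?I p" for p
  proof (cases "p \<in> bad_points \<rho>")
    case True
    then show ?thesis using bounded_borelD(2)[OF bF, of p] bounded_borelD(2)[OF b\<psi>, of p] e1 by simp
  next
    case False
    then have "snd p \<in> good_lines \<rho>" by (cases p) (auto simp: bad_points_def)
    then obtain r where "\<bar>r\<bar> \<le> \<rho>" "snd p = line_of (1, r)" using \<rho> by (auto elim: good_lineE)
    then show ?thesis
      using markov3_slope[OF b \<kappa>, of r \<rho> "fst p"] False by (cases p) (simp add: \<psi>_def)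
  qed
  let ?W = "\<lambda>p. ?e1 + 2 * B * ?I p"
  note bW = bounded_borel_add[OF bounded_borel_const[of ?e1] bounded_borel_cmult[OF bI, of "2 * B"]]
  have W: "(markov ^^ 3) ?W z \<le> ?e1 + 2 * B * ?e2" for z
  proof -
    \<comment> \<open>The innermost average is the third step in time; its bound holds from every
      starting point, so the two preceding steps only average a constant bound.\<close>
    have "(markov ^^ 3) ?I z = (markov ^^ 2) (markov ?I) z"
      by (simp add: numeral_3_eq_3 numeral_2_eq_2)
    also have "\<dots> \<le> (markov ^^ 2) (\<lambda>z. ?e2) z"
      by (rule markov_pow_mono[OF bounded_borel_markov[OF bI] bounded_borel_const markov_bad_points[OF \<kappa> \<rho>]])
    finally have "(markov ^^ 3) ?I z \<le> ?e2" by (simp add: markov_pow_const)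
    then have "2 * B * (markov ^^ 3) ?I z \<le> 2 * B * ?e2" using B0 by (intro mult_left_mono) auto
    then show ?thesis
      by (simp add: markov_pow_add[OF bounded_borel_const bounded_borel_cmult[OF bI]] markov_pow_const markov_pow_cmult)
  qed
  have step: "\<bar>(markov ^^ 6) \<phi> z - (markov ^^ 3) \<psi> z\<bar> \<le> ?e1 + 2 * B * ?e2" for z
  proof -
    have "(markov ^^ 6) \<phi> z = (markov ^^ 3) ?F z"
      using funpow_add[of 3 3 markov] by simp
    moreover have "(markov ^^ 3) ?F z - (markov ^^ 3) \<psi> z \<le> (markov ^^ 3) ?W z"
      using markov_pow_mono[OF bounded_borel_diff[OF bF b\<psi>] bW, of 3 z] near
      by (simp add: markov_pow_diff[OF bF b\<psi>] abs_le_iff)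
    moreover have "(markov ^^ 3) \<psi> z - (markov ^^ 3) ?F z \<le> (markov ^^ 3) ?W z"
      using markov_pow_mono[OF bounded_borel_diff[OF b\<psi> bF] bW, of 3 z] near
      by (simp add: markov_pow_diff[OF b\<psi> bF] abs_le_iff)
    ultimately show ?thesis using W[of z] by linarith
  qed
  obtain c where c: "\<bar>(markov ^^ 3) \<psi> z - c\<bar> \<le> ?e3" for z
  proof -
    have "\<bar>\<psi> (tor x y, l) - \<psi> (tor x' y, l)\<bar> \<le> B / \<sigma> * \<bar>x - x'\<bar>" for x x' y l
      using markov_lipschitz_fst[OF bounded_borel_markov_pow[OF b, of 2]]
      by (simp add: \<psi>_def numeral_3_eq_3 numeral_2_eq_2)
    then show ?thesis using markov3_torus[OF b\<psi> \<kappa>] that by (auto simp: \<psi>_def)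
  qed
  have aux: "\<bar>a - a'\<bar> \<le> 2 * e + 2 * d"
    if "\<bar>a - p\<bar> \<le> e" "\<bar>a' - p'\<bar> \<le> e" "\<bar>p - c\<bar> \<le> d" "\<bar>p' - c\<bar> \<le> d" for a a' p p' e d c :: real
    using that by linarith
  have "\<bar>(markov ^^ 6) \<phi> z - (markov ^^ 6) \<phi> z'\<bar> \<le> 2 * (?e1 + 2 * B * ?e2) + 2 * ?e3"
    using aux[OF step[of z] step[of z'] c[of z] c[of z']] .
  also have "\<dots> = B * (24 * \<rho> / (\<sigma>\<^sup>2 * \<kappa> ^ 3) + 4 / (L * \<rho> * \<kappa> * \<sigma>) + 48 / (\<sigma>\<^sup>2 * L * \<kappa> ^ 3) + 32 * \<kappa> / \<sigma>)"
    by (simp add: add_divide_distrib) (simp add: algebra_simps)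
  finally show ?thesis .
qed

end

section \<open>From the Koopman operator to the theorem\<close>

lemma bdd_measurable_bounded_borel: "bdd_measurable \<phi> \<Longrightarrow> bounded_borel (sup_norm \<phi>) \<phi>"
  unfolding bdd_measurable_def bounded_borel_def sup_norm_def bounded_iff
  by (auto intro!: cSUP_upper bdd_aboveI)

lemma bounded_borel_bdd_measurable: "bounded_borel B \<phi> \<Longrightarrow> bdd_measurable \<phi>"
  unfolding bdd_measurable_def bounded_borel_def bounded_iff by auto

text \<open>The Koopman operator reads only coordinate 0 of the noise, so the product measure may be
  replaced by its marginal.\<close>

lemma (in random_standard_map) koopman_markov:
  assumes "\<sigma> = L powr (- \<delta>)" "bounded_borel B \<phi>"
  shows "koopman L \<delta> \<phi> = markov \<phi>"
proof
  fix z
  let ?U = "uniform_measure lborel {- \<sigma>..\<sigma>}"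
  have "prob_space ?U" using \<sigma> by (intro prob_space_uniform_Icc) simp
  then have d: "distr (noise L \<delta>) ?U (\<lambda>\<omega>. \<omega> 0) = ?U"
    unfolding noise_def assms(1) by (intro distr_PiM_component) auto
  have "koopman L \<delta> \<phi> z = (\<integral>w. \<phi> (proj_step L w z) \<partial>distr (noise L \<delta>) ?U (\<lambda>\<omega>. \<omega> 0))"
    unfolding koopman_def
  proof (rule integral_distr[symmetric])
    show "(\<lambda>\<omega>. \<omega> 0) \<in> noise L \<delta> \<rightarrow>\<^sub>M ?U"
      unfolding noise_def assms(1) by (rule measurable_component_singleton) simp
    show "(\<lambda>w. \<phi> (proj_step L w z)) \<in> borel_measurable ?U"
      by (rule measurable_observable[OF bounded_borelD(1)[OF assms(2)]])
  qed
  then show "koopman L \<delta> \<phi> z = markov \<phi> z" by (simp only: d markov_def)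
qed

lemma (in random_standard_map) koopman_pow_markov:
  assumes "\<sigma> = L powr (- \<delta>)" "bounded_borel B \<phi>"
  shows "(koopman L \<delta> ^^ n) \<phi> = (markov ^^ n) \<phi>"
  by (induction n) (simp_all add: koopman_markov[OF assms(1) bounded_borel_markov_pow[OF assms(2)]])

text \<open>Each of the four terms is at most its coefficient times \<open>L powr (- 1 / 16 + 2 * \<delta>)\<close>; the
  coefficients add up to 108, and \<open>54 \<le> L powr (1 / 27)\<close> absorbs the constant because
  \<open>1 / 27 < 1 / 16 - 5 / 2 * \<delta>\<close>.\<close>

lemma powr_error_bound:
  fixes L \<delta> :: real
  assumes \<delta>: "0 < \<delta>" "\<delta> < 1 / 100" and L: "54 powr 27 < L"
  defines "\<sigma> \<equiv> L powr (- \<delta>)" and "\<kappa> \<equiv> L powr (- 1 / 16)" and "\<rho> \<equiv> L powr (- 1 / 2)"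
  shows "24 * \<rho> / (\<sigma>\<^sup>2 * \<kappa> ^ 3) + 4 / (L * \<rho> * \<kappa> * \<sigma>) + 48 / (\<sigma>\<^sup>2 * L * \<kappa> ^ 3) + 32 * \<kappa> / \<sigma>
    \<le> 2 * L powr (- (\<delta> / 2))"
proof -
  have "(1::real) \<le> 54 powr 27" by (rule ge_one_powr_ge_zero) auto
  then have L1: "1 < L" using L by linarith
  then have pow: "\<sigma>\<^sup>2 = L powr (- \<delta> * 2)" "\<kappa> ^ 3 = L powr (- 1 / 16 * 3)"
    unfolding \<sigma>_def \<kappa>_def by (simp_all add: powr_powr flip: powr_realpow)
  let ?m = "L powr (- 1 / 16 + 2 * \<delta>)"
  have m: "L powr a \<le> ?m" if "a \<le> - 1 / 16 + 2 * \<delta>" for a using that L1 by (intro powr_mono) auto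
  have 1: "\<rho> / (\<sigma>\<^sup>2 * \<kappa> ^ 3) \<le> ?m"
    unfolding pow(1,2) \<rho>_def powr_add[symmetric] powr_diff[symmetric] using \<delta> by (intro m) auto
  have 2: "1 / (L * \<rho> * \<kappa> * \<sigma>) \<le> ?m"
  proof -
    have "L * \<rho> * \<kappa> * \<sigma> = L powr (1 + - 1 / 2 + - 1 / 16 + - \<delta>)"
      unfolding powr_add \<rho>_def \<kappa>_def \<sigma>_def using L1 by simp
    then have "1 / (L * \<rho> * \<kappa> * \<sigma>) = L powr (- (1 + - 1 / 2 + - 1 / 16 + - \<delta>))"
      by (simp only: powr_minus_divide)
    also have "\<dots> \<le> ?m" using \<delta> by (intro m) auto
    finally show ?thesis .
  qed
  have 3: "1 / (\<sigma>\<^sup>2 * L * \<kappa> ^ 3) \<le> ?m"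
  proof -
    have "\<sigma>\<^sup>2 * L * \<kappa> ^ 3 = L powr (- \<delta> * 2 + 1 + - 1 / 16 * 3)"
      unfolding powr_add pow(1,2) using L1 by simp
    then have "1 / (\<sigma>\<^sup>2 * L * \<kappa> ^ 3) = L powr (- (- \<delta> * 2 + 1 + - 1 / 16 * 3))"
      by (simp only: powr_minus_divide)
    also have "\<dots> \<le> ?m" using \<delta> by (intro m) auto
    finally show ?thesis .
  qed
  have 4: "\<kappa> / \<sigma> \<le> ?m"
    unfolding \<kappa>_def \<sigma>_def powr_diff[symmetric] using \<delta> by (intro m) auto
  have "54 = ((54::real) powr 27) powr (1 / 27)" by (subst powr_powr) simp
  also have "\<dots> \<le> L powr (1 / 27)" using L by (intro powr_mono2) auto
  also have "\<dots> \<le> L powr (1 / 16 - 5 / 2 * \<delta>)" using \<delta> L1 by (intro powr_mono) auto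
  finally have "54 * ?m \<le> L powr (1 / 16 - 5 / 2 * \<delta>) * ?m" by (intro mult_right_mono) auto
  also have "\<dots> = L powr (- (\<delta> / 2))" by (simp flip: powr_add)
  finally have "108 * ?m \<le> 2 * L powr (- (\<delta> / 2))" by simp
  then show ?thesis using 1 2 3 4 by simp
qed

theorem theorem2p3:
  shows "\<exists>M::nat. M \<ge> 1 \<and> (\<exists>\<delta>0::real. \<delta>0 > 0 \<and> (\<forall>\<delta>::real. 0 < \<delta> \<and> \<delta> < \<delta>0 \<longrightarrow>
    (\<exists>L0::real. L0 > 0 \<and> (\<forall>L::real. L > L0 \<longrightarrow>
      (\<exists>\<nu>. stationary L \<delta> \<nu> \<and> (\<forall>\<nu>'. stationary L \<delta> \<nu>' \<longrightarrow> \<nu>' = \<nu>) \<and>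
           ergodic L \<delta> \<nu> \<and> mixing L \<delta> \<nu> \<and>
           (\<forall>(n::nat) \<phi>. bdd_measurable \<phi> \<longrightarrow>
              sup_norm (\<lambda>z. (koopman L \<delta> ^^ n) \<phi> z - (\<integral>z'. \<phi> z' \<partial>\<nu>))
                \<le> 2 * L powr (- (\<delta> / 2) * real (n div M)) * sup_norm \<phi>))))))"
proof -
  have main: "\<exists>\<nu>. stationary L \<delta> \<nu> \<and> (\<forall>\<nu>'. stationary L \<delta> \<nu>' \<longrightarrow> \<nu>' = \<nu>) \<and>
           ergodic L \<delta> \<nu> \<and> mixing L \<delta> \<nu> \<and>
           (\<forall>(n::nat) \<phi>. bdd_measurable \<phi> \<longrightarrow>
              sup_norm (\<lambda>z. (koopman L \<delta> ^^ n) \<phi> z - (\<integral>z'. \<phi> z' \<partial>\<nu>))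
                \<le> 2 * L powr (- (\<delta> / 2) * real (n div 6)) * sup_norm \<phi>)"
    \<comment> \<open>Beyond \<open>4 powr (1 / \<delta>)\<close> the noise satisfies \<sigma> \<le>
      1/4; beyond \<open>54 powr 27\<close> the numerical constants are absorbed, and \<kappa> \<le>
      1/6 follows since 6^16 \<le> 54^27.\<close>
    if \<delta>: "0 < \<delta>" "\<delta> < 1 / 100" and L: "max (54 powr 27) (4 powr (1 / \<delta>)) < L" for \<delta> L :: real
  proof -
    have L27: "54 powr 27 < L" using L by (simp only: max_less_iff_conj)
    define \<sigma> where "\<sigma> = L powr (- \<delta>)"
    define \<kappa> where "\<kappa> = L powr (- 1 / 16)"
    define \<rho> where "\<rho> = L powr (- 1 / 2)"
    define \<theta> where "\<theta> = L powr (- (\<delta> / 2))"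
    have "(1::real) \<le> 54 powr 27" by (rule ge_one_powr_ge_zero) auto
    then have L1: "1 < L" using L by linarith
    have "4 = ((4::real) powr (1 / \<delta>)) powr \<delta>" using \<delta> by (simp add: powr_powr)
    also have "\<dots> \<le> L powr \<delta>" using L \<delta> by (intro powr_mono2) auto
    finally have \<sigma>: "0 < \<sigma>" "\<sigma> \<le> 1 / 4"
      using L1 by (auto simp: \<sigma>_def powr_minus_divide intro!: divide_left_mono)
    have "(6::real) = (6 powr 16) powr (1 / 16)" by (subst powr_powr) simp
    also have "\<dots> \<le> (54 powr 27) powr (1 / 16)"
      using powr_mono[of 16 27 54] powr_mono2[of 16 6 54] by (intro powr_mono2) auto
    also have "\<dots> \<le> L powr (1 / 16)" using L by (intro powr_mono2) auto
    finally have \<kappa>: "0 < \<kappa>" "\<kappa> \<le> 1 / 6"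
      using L1 by (auto simp: \<kappa>_def powr_minus_divide intro!: divide_left_mono)
    have \<rho>: "0 < \<rho>" using L1 by (simp add: \<rho>_def)
    have \<theta>: "0 \<le> \<theta>" "\<theta> < 1" using L1 \<delta> powr_less_mono[of "- (\<delta> / 2)" 0 L] by (auto simp: \<theta>_def)
    interpret random_standard_map L \<sigma> using L1 \<sigma> by unfold_locales auto
    interpret contracting_random_map "uniform_measure lborel {- \<sigma>..\<sigma>}" "proj_step L" 6 \<theta>
    proof
      fix B and \<phi> :: "proj_bundle \<Rightarrow> real" and z z' assume b: "bounded_borel B \<phi>"
      have "B * (24 * \<rho> / (\<sigma>\<^sup>2 * \<kappa> ^ 3) + 4 / (L * \<rho> * \<kappa> * \<sigma>) + 48 / (\<sigma>\<^sup>2 * L * \<kappa> ^ 3) + 32 * \<kappa> / \<sigma>) \<le> B * (2 * \<theta>)"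
        using bounded_borel_nonneg[OF b] powr_error_bound[OF \<delta> L27]
        unfolding \<sigma>_def \<kappa>_def \<rho>_def \<theta>_def by (intro mult_left_mono) auto
      then show "\<bar>(markov ^^ 6) \<phi> z - (markov ^^ 6) \<phi> z'\<bar> \<le> 2 * (\<theta> * B)"
        using markov6_oscillation[OF b \<kappa> \<rho>, of z z'] by (simp add: mult.commute mult.left_commute)
    qed (use \<theta> in auto)
    note koopman = koopman_markov[OF \<sigma>_def] and koopman_pow = koopman_pow_markov[OF \<sigma>_def]
    note bb = bdd_measurable_bounded_borel
    have st: "stationary L \<delta> invariant"
      unfolding stationary_def
      using prob_space_invariant sets_invariant integral_invariant_markov koopman bb by metis
    moreover have "\<nu>' = invariant" if "stationary L \<delta> \<nu>'" for \<nu>'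
    proof (rule invariant_unique)
      show "prob_space \<nu>'" "sets \<nu>' = sets borel" using that by (auto simp: stationary_def)
      fix B and \<phi> :: "proj_bundle \<Rightarrow> real" assume b: "bounded_borel B \<phi>"
      have "integral\<^sup>L \<nu>' (koopman L \<delta> \<phi>) = integral\<^sup>L \<nu>' \<phi>"
        using that bounded_borel_bdd_measurable[OF b] unfolding stationary_def by blast
      then show "integral\<^sup>L \<nu>' (markov \<phi>) = integral\<^sup>L \<nu>' \<phi>" by (simp only: koopman[OF b])
    qed
    moreover have "ergodic L \<delta> invariant"
      unfolding ergodic_def using st koopman[OF bb] invariant_ergodic[OF bb] by auto
    moreover have "mixing L \<delta> invariant"
      unfolding mixing_def using st koopman_pow[OF bb] invariant_mixing[OF bb bb] by auto
    moreover have "sup_norm (\<lambda>z. (koopman L \<delta> ^^ n) \<phi> z - (\<integral>z'. \<phi> z' \<partial>invariant))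
        \<le> 2 * L powr (- (\<delta> / 2) * real (n div 6)) * sup_norm \<phi>" if "bdd_measurable \<phi>" for n \<phi>
    proof -
      have "\<theta> ^ (n div 6) = L powr (- (\<delta> / 2) * real (n div 6))"
        using L1 by (simp add: \<theta>_def powr_powr flip: powr_realpow)
      then have "\<bar>(koopman L \<delta> ^^ n) \<phi> z - (\<integral>z'. \<phi> z' \<partial>invariant)\<bar>
          \<le> 2 * L powr (- (\<delta> / 2) * real (n div 6)) * sup_norm \<phi>" for z
        using invariant_rate[OF bb[OF that], of n z] koopman_pow[OF bb[OF that], of n] by simp
      then show ?thesis unfolding sup_norm_def by (intro cSUP_least) auto
    qed
    ultimately show ?thesis by blast
  qed
  show ?thesis
  \<comment> \<open>The block length 6 is three steps for the position followed by three for the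
    direction, and depends on neither L nor \<delta>.\<close>
  proof (rule exI[of _ "6::nat"], rule conjI, simp, rule exI[of _ "1 / 100 :: real"], intro conjI allI impI)
    fix \<delta> :: real assume "0 < \<delta> \<and> \<delta> < 1 / 100"
    then show "\<exists>L0::real. L0 > 0 \<and> (\<forall>L::real. L > L0 \<longrightarrow>
      (\<exists>\<nu>. stationary L \<delta> \<nu> \<and> (\<forall>\<nu>'. stationary L \<delta> \<nu>' \<longrightarrow> \<nu>' = \<nu>) \<and>
           ergodic L \<delta> \<nu> \<and> mixing L \<delta> \<nu> \<and>
           (\<forall>(n::nat) \<phi>. bdd_measurable \<phi> \<longrightarrow>
              sup_norm (\<lambda>z. (koopman L \<delta> ^^ n) \<phi> z - (\<integral>z'. \<phi> z' \<partial>\<nu>))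
                \<le> 2 * L powr (- (\<delta> / 2) * real (n div 6)) * sup_norm \<phi>)))"
      using main[of \<delta>] by (intro exI[of _ "max (54 powr 27) (4 powr (1 / \<delta>))"]) auto
  qed auto
qed

end
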